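(* Let $T=(V,E)$ be a tree of size $p=|V|\ge 2$. Let $\mathbf{C}=[c_{i,j}]_{i,j\in V}\in C_T$ and, for $r\in V$, let $\Phi_r$ be the transformation associated with the rooted tree $T_r$ and $\mathbf{C}$ (defined in the context). Let $\mathbf{X}=(X_i,\,i\in V)$ be a $p$-dimensional random vector with positive density which is continuously differentiable on its support $(0,\infty)^p$. Suppose that for every $r\in V$ which is a leaf of $T$, the components of the random vector $\mathbf{X}_{(r)}=\Phi_r(\mathbf{X})=(X_{i,(r)},\,i\in V)$ are independent. Then there exist $\mathbf{a}=(a_i,\,i\in V)\in(0,\infty)^p$ and $c>0$ such that, for every leaf $r$ of $T$, $X_{r,(r)}\sim\mathcal{G}(a_r,c\,c_r)$ and $$\frac{c_{\mathfrak{p}_r(i),i}}{c_{\mathfrak{p}_r(i)}}\,X_{i,(r)}\sim\mathcal{K}\left(a_i,\;a_{\mathfrak{p}_r(i)}-a_i,\;c\,\frac{c_{\mathfrak{p}_r(i)}\,c_i}{c_{\mathfrak{p}_r(i),i}}\right)\quad\text{for } i\in V\setminus\{r\}.$$ Consequently, $\mathbf{X}\sim\mathrm{TK}(\mathbf{a},c\,\mathbf{C})$.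
   Context: A tree is a finite, connected, acyclic undirected graph $T=(V,E)$; a leaf is a vertex of degree $1$. A subtree $S$ of $T$, written $S\subseteq T$, is a tree $S=(V(S),E(S))$ with $\emptyset\neq V(S)\subseteq V$ and $E(S)=\{\{i,j\}\in E:\ i,j\in V(S)\}$ (in particular $S$ is connected; single vertices are allowed). $\deg_S(i)$ is the degree of vertex $i$ in $S$. For a root $r\in V$, $T_r$ denotes $T$ directed away from $r$; $\mathfrak{C}_r(i)$ is the set of children of $i$ in $T_r$, and $\mathfrak{p}_r(i)$ is the unique parent of $i\neq r$ in $T_r$. $C_T$ is the set of symmetric matrices $\mathbf{C}=[c_{i,j}]_{i,j\in V}$ with $c_{i,j}>0$ when $\{i,j\}\in E$, $c_{i,i}=:c_i>0$ for $i\in V$, and $c_{i,j}=0$ otherwise. Given $\mathbf{C}\in C_T$ and $r\in V$, the map $\Phi_r:(0,\infty)^p\to(0,\infty)^p$ is $\Phi_r(s_i,\,i\in V)=(s_{i,(r)},\,i\in V)$, where, recursively starting from the vertices farthest from $r$, $$s_{i,(r)}=s_i\prod_{j\in\mathfrak{C}_r(i)}\left(1+\frac{c_{i,j}}{c_i}\,s_{j,(r)}\right),$$ an empty product being equal to $1$. For $\mathbf{a}=(a_i,\,i\in V)\in(0,\infty)^p$ and $\mathbf{C}\in C_T$, the tree-Kummer distribution $\mathrm{TK}(\mathbf{a},\mathbf{C})$ is the probability distribution on $(0,\infty)^p$ with density $$f(\mathbf{x})\propto\prod_{i\in V}x_i^{a_i-1}\,\exp\left(-\sum_{S\subseteq T}\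 \prod_{i\in V(S)}\frac{x_i}{c_i^{\deg_S(i)-1}}\prod_{\{j,k\}\in E(S)}c_{j,k}\right)\mathbf{1}_{(0,\infty)^p}(\mathbf{x}),$$ the sum being over all subtrees $S$ of $T$. $\mathrm{TK}(\mathbf{a},c\,\mathbf{C})$ is the same with every entry $c_{i,j}$ and $c_i$ replaced by $c\,c_{i,j}$ and $c\,c_i$. For $\alpha,\gamma>0$ and $\beta\in\mathbb{R}$, the Kummer distribution $\mathcal{K}(\alpha,\beta,\gamma)$ has density proportional to $\frac{x^{\alpha-1}}{(1+x)^{\alpha+\beta}}e^{-\gamma x}\mathbf{1}_{(0,\infty)}(x)$; for $\alpha,\gamma>0$, the Gamma distribution $\mathcal{G}(\alpha,\gamma)$ has density proportional to $x^{\alpha-1}e^{-\gamma x}\mathbf{1}_{(0,\infty)}(x)$. *)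

theory Defs
  imports "HOL-Probability.Probability"
begin

text \<open>A graph is a vertex set together with a set of two-element vertex sets. It is given in this
  generality, rather than on a whole type only, since subtrees live on smaller vertex sets.\<close>

definition adj_rel :: "'v set set \<Rightarrow> ('v \<times> 'v) set" where
  "adj_rel E = {(u, v). {u, v} \<in> E}"

definition connected_graph :: "'v set \<Rightarrow> 'v set set \<Rightarrow> bool" where
  "connected_graph V E \<longleftrightarrow> (\<forall>u\<in>V. \<forall>v\<in>V. (u, v) \<in> (adj_rel E)\<^sup>*)"

definition graph_cycle :: "'v set set \<Rightarrow> 'v list \<Rightarrow> bool" where
  "graph_cycle E vs \<longleftrightarrow>
     3 \<le> length vs \<and> distinct vs \<and> successively (\<lambda>u v. {u, v} \<in> E) vs \<and> {last vs, hd vs} \<in> E"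

definition is_tree :: "'v set \<Rightarrow> 'v set set \<Rightarrow> bool" where
  "is_tree V E \<longleftrightarrow>
     finite V \<and> V \<noteq> {} \<and> (\<forall>e\<in>E. e \<subseteq> V \<and> card e = 2) \<and>
     connected_graph V E \<and> (\<nexists>vs. graph_cycle E vs)"

definition vdegree :: "'v set set \<Rightarrow> 'v \<Rightarrow> nat" where
  "vdegree E v = card {e \<in> E. v \<in> e}"

definition is_leaf :: "'v set set \<Rightarrow> 'v \<Rightarrow> bool" where
  "is_leaf E v \<longleftrightarrow> vdegree E v = 1"

definition subtrees :: "'v set \<Rightarrow> 'v set set \<Rightarrow> ('v set \<times> 'v set set) set" where
  "subtrees V E = {(W, F). W \<noteq> {} \<and> W \<subseteq> V \<and> F = {e \<in> E. e \<subseteq> W} \<and> is_tree W F}"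

definition graph_dist :: "'v set set \<Rightarrow> 'v \<Rightarrow> 'v \<Rightarrow> nat" where
  "graph_dist E u v = (LEAST n. (u, v) \<in> adj_rel E ^^ n)"

text \<open>Directing a tree away from \<open>r\<close> orients each edge towards its endpoint farther from \<open>r\<close>.\<close>

definition children :: "'v set set \<Rightarrow> 'v \<Rightarrow> 'v \<Rightarrow> 'v set" where
  "children E r i = {j. {i, j} \<in> E \<and> graph_dist E r j = graph_dist E r i + 1}"

definition parent :: "'v set set \<Rightarrow> 'v \<Rightarrow> 'v \<Rightarrow> 'v" where
  "parent E r i = (THE j. i \<in> children E r j)"

definition tree_matrices :: "'v set set \<Rightarrow> (real ^ 'v ^ 'v::finite) set" where
  "tree_matrices E =
     {C. transpose C = C \<and> (\<forall>i. C $ i $ i > 0) \<and>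
         (\<forall>i j. {i, j} \<in> E \<longrightarrow> C $ i $ j > 0) \<and>
         (\<forall>i j. i \<noteq> j \<longrightarrow> {i, j} \<notin> E \<longrightarrow> C $ i $ j = 0)}"

function Phi_comp ::
    "'v set set \<Rightarrow> real ^ 'v ^ 'v \<Rightarrow> 'v::finite \<Rightarrow> real ^ 'v \<Rightarrow> 'v \<Rightarrow> real" where
  "Phi_comp E C r s i =
     s $ i * (\<Prod>j\<in>children E r i. 1 + C $ i $ j / C $ i $ i * Phi_comp E C r s j)"
  by pat_completeness auto
termination
proof (relation "Wellfounded.measure (\<lambda>(E, C, r, s, i). Max (range (graph_dist E r)) - graph_dist E r i)")
  fix E :: "'v::finite set set" and C :: "real ^ 'v::finite ^ 'v::finite" and r i j :: "'v::finite"
    and s :: "real ^ 'v::finite"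
  assume "j \<in> children E r i"
  then have "graph_dist E r i < graph_dist E r j"
    by (simp add: children_def)
  moreover have "graph_dist E r j \<le> Max (range (graph_dist E r))"
    by (rule Max_ge) auto
  ultimately have "Max (range (graph_dist E r)) - graph_dist E r j
      < Max (range (graph_dist E r)) - graph_dist E r i"
    by linarith
  then show "((E, C, r, s, j), (E, C, r, s, i))
      \<in> Wellfounded.measure (\<lambda>(E, C, r, s, i). Max (range (graph_dist E r)) - graph_dist E r i)"
    by simp
qed simp

text \<open>The recursion equation must not be used as a rewrite rule, since it loops.\<close>
declare Phi_comp.simps [simp del]

definition Phi :: "'v set set \<Rightarrow> real ^ 'v ^ 'v \<Rightarrow> 'v::finite \<Rightarrow> real ^ 'v \<Rightarrow> real ^ 'v" where
  "Phi E C r s = (\<chi> i. Phi_comp E C r s i)"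

definition pos_orthant :: "(real ^ 'v::finite) set" where
  "pos_orthant = {x. \<forall>i. 0 < x $ i}"

text \<open>The measure with density proportional to \<open>w\<close>. It is a probability measure iff \<open>w\<close> (nonnegative
  and measurable in all uses below) has a finite nonzero integral; otherwise the quotient is \<open>0\<close>
  almost everywhere, so this is the zero measure and hence not the law of any random variable.\<close>

definition dist_prop_to :: "('b::euclidean_space \<Rightarrow> real) \<Rightarrow> 'b measure" where
  "dist_prop_to w = density lborel (\<lambda>x. ennreal (w x / (LINT y|lborel. w y)))"

definition gamma_dist :: "real \<Rightarrow> real \<Rightarrow> real measure" where
  "gamma_dist \<alpha> \<gamma> = dist_prop_to (\<lambda>x. x powr (\<alpha> - 1) * exp (- \<gamma> * x) * indicator {0<..} x)"

definition kummer_dist :: "real \<Rightarrow> real \<Rightarrow> real \<Rightarrow> real measure" where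
  "kummer_dist \<alpha> \<beta> \<gamma> =
     dist_prop_to (\<lambda>x. x powr (\<alpha> - 1) / (1 + x) powr (\<alpha> + \<beta>) * exp (- \<gamma> * x) * indicator {0<..} x)"

text \<open>The entry at an unordered pair, well defined for symmetric matrices.\<close>

definition edge_entry :: "real ^ 'v ^ 'v::finite \<Rightarrow> 'v set \<Rightarrow> real" where
  "edge_entry C e = (THE c. \<exists>j k. e = {j, k} \<and> c = C $ j $ k)"

text \<open>The exponent \<open>deg - 1\<close> equals \<open>-1\<close> for a single-vertex subtree, hence the integer power.\<close>

definition tree_kummer_exponent :: "'v set set \<Rightarrow> real ^ 'v ^ 'v \<Rightarrow> real ^ 'v::finite \<Rightarrow> real" where
  "tree_kummer_exponent E C x =
     (\<Sum>(W, F)\<in>subtrees UNIV E.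
        (\<Prod>i\<in>W. x $ i / (C $ i $ i) powi (int (vdegree F i) - 1)) * (\<Prod>e\<in>F. edge_entry C e))"

definition tree_kummer_dist ::
    "'v set set \<Rightarrow> real ^ 'v \<Rightarrow> real ^ 'v ^ 'v::finite \<Rightarrow> (real ^ 'v) measure" where
  "tree_kummer_dist E a C =
     dist_prop_to (\<lambda>x. (\<Prod>i\<in>UNIV. x $ i powr (a $ i - 1)) * exp (- tree_kummer_exponent E C x)
                        * indicator pos_orthant x)"

end

theory Submission
  imports Defs "HOL-Real_Asymp.Real_Asymp"
begin

text \<open>In the coordinates \<open>s = Phi r x\<close> the coordinate \<open>x_i\<close> is \<open>s_i\<close> divided
  by a product over the children of \<open>i\<close>, so the Jacobian factorizes and independence for a leaf
  root \<open>r\<close> says that \<open>log f\<close> is a sum of functions of the single \<open>s_i\<close>.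
  With \<open>D_i = x_i * d log f / d x_i\<close>, this means that \<open>D_i - rho * s_i / (1 + rho * s_i) *
  D_p\<close> depends on \<open>s_i\<close> only, where \<open>p\<close> is the parent of \<open>i\<close> and
  \<open>rho = c_pi / c_p\<close>. The message from \<open>i\<close> to its parent, \<open>s_i\<close>, does not
  depend on which root lies behind the parent. Every edge is seen in both directions from suitable leaves, so
  \<open>D_i\<close> is a function of the two messages along any edge at \<open>i\<close>; comparing two edges
  at \<open>i\<close>, it is a function \<open>G_i\<close> of the message at the root \<open>i\<close> alone.
  Each edge now yields a pair of functional equations for \<open>G_i\<close> and \<open>G_j\<close> whose
  continuous solutions are affine with proportional slopes. Integrating back gives a product density in the
  coordinates \<open>s\<close>, and integrability forces the signs of the parameters.\<close>

section \<open>A functional equation\<close>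

text \<open>Independence concerns laws, whereas the argument needs pointwise identities for
  \<open>f\<close>. Continuity bridges the gap: probabilities of small cubes factorize, and
  shrinking the cubes gives the four-point identity
  \<open>q s * q s' = q (vupd s i (s' $ i)) * q (vupd s' i (s $ i))\<close>. No marginal density has
  to be chosen in it, and the Jacobian cancels. Differentiating it in one coordinate yields the
  identities for \<open>D\<close>.

  An edge equation couples \<open>D i\<close> to \<open>D j\<close> through a factor
  \<open>logistic\<close> strictly between 0 and 1. The two directions of an edge thus form a linear
  system with determinant 1 - \<alpha> * \<beta> > 0, which is why a leaf is sought on each side of
  every edge.

  On an edge the slopes come out as \<kappa> times C_ii and C_jj, and connectedness makes \<kappa>
  one constant \<open>c\<close>. It becomes the scale of the matrix because the tree-Kummer exponent
  is the sum of C_ii * s_i, whichever vertex is the root. The intercepts \<open>A i\<close> are a_i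
  - 1; the Jacobian supplies one further power of 1 + rho * s_i, so that the Kummer exponent is a_p
  for the parent p.\<close>

text \<open>Writing \<open>N a b = F b / b - E a / a\<close>, the two equations combine to \<open>N (a (1 + b)) (b (1 +
  a)) = N a b / (1 + a + b)\<close>. The map \<open>(a, b) \<mapsto> (a (1 + b), b (1 + a))\<close> preserves
  \<open>b - a\<close>; along its backward orbits \<open>a\<close> tends to \<open>0\<close> while \<open>a *
  \<bar>N a b\<bar>\<close> does not decrease, so \<open>N\<close> must vanish on \<open>a \<le> b\<close>.\<close>

lemma affine_of_differences:
  fixes F E :: "real \<Rightarrow> real"
  assumes F0: "(F \<longlongrightarrow> 0) (at_right 0)" and E0: "(E \<longlongrightarrow> 0) (at_right 0)"
    and eqF: "\<And>a b. a > 0 \<Longrightarrow> b > 0 \<Longrightarrow> F (b * (1 + a)) - F b = b / (1 + b) * E (a * (1 + b))"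
    and eqE: "\<And>a b. a > 0 \<Longrightarrow> b > 0 \<Longrightarrow> E (a * (1 + b)) - E a = a / (1 + a) * F (b * (1 + a))"
  shows "\<exists>k. \<forall>x>0. F x = k * x \<and> E x = k * x"
proof -
  define N where "N a b = F b / b - E a / a" for a b
  have step: "N (a * (1 + b)) (b * (1 + a)) * (1 + a + b) = N a b" if ab: "a > 0" "b > 0" for a b
  proof -
    define p q where "p = F (b * (1 + a))" and "q = E (a * (1 + b))"
    have p: "(1 + b) * (p - F b) = b * q" and q: "(1 + a) * (q - E a) = a * p"
      using eqF[OF ab] eqE[OF ab] ab by (simp_all add: p_def q_def field_simps)
    have "(a * (1 + b) * p - b * (1 + a) * q) * (1 + a + b) =
        (1 + a) * (1 + b) * (a * F b - b * E a)"
      using p q by algebra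
    moreover have "p / (b * (1 + a)) - q / (a * (1 + b)) =
        (a * (1 + b) * p - b * (1 + a) * q) / (a * b * ((1 + a) * (1 + b)))"
      using ab by (simp add: divide_simps)
    moreover have "F b / b - E a / a = (a * F b - b * E a) / (a * b)"
      using ab by (simp add: divide_simps)
    ultimately show ?thesis
      using ab by (simp add: N_def flip: p_def q_def)
  qed
  have N0: "N a b = 0" if "0 < a" "a \<le> b" for a b
  proof -
    define d where "d = b - a"
    have d: "d \<ge> 0" using that by (simp add: d_def)
    \<comment> \<open>\<open>pre t\<close> is the positive root \<open>v\<close> of v * (1 + v + d)
      = t. With \<open>b = a + d\<close> the map sends \<open>a\<close> to a * (1 + a + d), so
      \<open>pre\<close> is one backward step of its first coordinate.\<close>
    define pre where "pre t = (sqrt ((1 + d)\<^sup>2 + 4 * t) - (1 + d)) / 2" for t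
    have pre: "pre t > 0" "pre t * (1 + pre t + d) = t" if "t > 0" for t
    proof -
      have "sqrt ((1 + d)\<^sup>2) < sqrt ((1 + d)\<^sup>2 + 4 * t)"
        using that by (intro real_sqrt_less_mono) simp
      then show "pre t > 0" using d by (simp add: pre_def)
      have "(sqrt ((1 + d)\<^sup>2 + 4 * t))\<^sup>2 = (1 + d)\<^sup>2 + 4 * t" using that by simp
      then show "pre t * (1 + pre t + d) = t"
        unfolding pre_def by (simp add: power2_eq_square field_simps)
    qed
    define u where "u n = (pre ^^ n) a" for n
    have u_Suc: "u (Suc n) = pre (u n)" for n by (simp add: u_def)
    have u_pos: "u n > 0" for n by (induction n) (simp_all add: u_def that pre)
    have u_rec: "u (Suc n) * (1 + u (Suc n) + d) = u n" for n
      using pre(2)[OF u_pos] by (simp add: u_Suc)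
    have "decseq u"
    proof (rule decseq_SucI)
      fix n
      have "u (Suc n) * 1 \<le> u (Suc n) * (1 + u (Suc n) + d)"
        using u_pos[of "Suc n"] d by (intro mult_left_mono) auto
      then show "u (Suc n) \<le> u n" by (simp add: u_rec)
    qed
    then obtain L where L: "u \<longlonglongrightarrow> L" "\<And>n. L \<le> u n"
      using decseq_convergent[of u 0] u_pos by (metis less_imp_le)
    have "(\<lambda>n. u (Suc n) * (1 + u (Suc n) + d)) \<longlonglongrightarrow> L * (1 + L + d)"
      using L(1)[THEN LIMSEQ_Suc] by (intro tendsto_intros)
    then have "u \<longlonglongrightarrow> L * (1 + L + d)" by (simp only: u_rec)
    \<comment> \<open>The limit is a fixed point, so L * (L + d) = 0, and both factors being
      nonnegative leaves only L = 0.\<close>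
    then have "L * (1 + L + d) = L" using L(1) by (rule LIMSEQ_unique)
    moreover have "L \<ge> 0" using LIMSEQ_le_const[OF L(1)] u_pos by (meson less_imp_le)
    ultimately have "L = 0" using d by (auto simp: algebra_simps add_nonneg_eq_0_iff)
    then have u0: "filterlim u (at_right 0) sequentially"
      using L(1) u_pos by (auto simp: filterlim_at less_imp_neq[symmetric])
    \<comment> \<open>With v = u (Suc n), \<open>step\<close> multiplies the absolute value of
      \<open>N\<close> by 1 + 2 * v + d, while u n = v * (1 + v + d) is at most v * (1 + 2 * v +
      d).\<close>
    have grow: "u 0 * \<bar>N (u 0) (u 0 + d)\<bar> \<le> u n * \<bar>N (u n) (u n + d)\<bar>" for n
    proof (induction n)
      case (Suc n)
      let ?v = "u (Suc n)"
      have v: "?v > 0" "?v + d > 0" using u_pos[of "Suc n"] d by auto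
      have "N (u n) (u n + d) * (1 + ?v + (?v + d)) = N ?v (?v + d)"
        using step[OF v] u_rec[of n] by (simp add: algebra_simps)
      then have "\<bar>N ?v (?v + d)\<bar> = \<bar>N (u n) (u n + d)\<bar> * (1 + ?v + (?v + d))"
        using v d by (simp add: abs_mult flip: \<open>N (u n) (u n + d) * _ = _\<close>)
      then have "?v * \<bar>N ?v (?v + d)\<bar> = (?v * (1 + ?v + (?v + d))) * \<bar>N (u n) (u n + d)\<bar>"
        by simp
      also have "\<dots> \<ge> u n * \<bar>N (u n) (u n + d)\<bar>"
        using v by (intro mult_right_mono) (auto simp flip: u_rec[of n] simp: algebra_simps)
      finally show ?case using Suc by simp
    qed simp
    have "((\<lambda>t. t * N t (t + d)) \<longlongrightarrow> 0) (at_right 0)"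
    proof -
      have eq: "t * N t (t + d) = t / (t + d) * F (t + d) - E t" if "t > 0" for t
        using that d by (simp add: N_def right_diff_distrib)
      have "((\<lambda>t. t / (t + d) * F (t + d)) \<longlongrightarrow> 0) (at_right 0)"
      proof (cases "d = 0")
        case True
        have "eventually (\<lambda>t. F t = t / (t + d) * F (t + d)) (at_right 0)"
          by (rule eventually_mono[OF eventually_at_right_less]) (simp add: True)
        then show ?thesis by (rule Lim_transform_eventually[OF F0])
      next
        case False
        then have dpos: "d > 0" using d by simp
        \<comment> \<open>\<open>F0\<close> says nothing about \<open>F\<close> near
          \<open>d\<close>. Equation \<open>eqF\<close> at b = d and a = t / d expresses F (t + d)
          by F d and a value of \<open>E\<close> at an argument tending to 0.\<close>
        have bound: "\<bar>t / (t + d) * F (t + d)\<bar> \<le> \<bar>t / (t + d) * F d\<bar> + \<bar>d / (1 + d) * E (t / d * (1 + d))\<bar>"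
          if "t > 0" for t
        proof -
          have "F (d * (1 + t / d)) - F d = d / (1 + d) * E (t / d * (1 + d))"
            using that dpos by (intro eqF) auto
          moreover have "d * (1 + t / d) = t + d" using dpos by (simp add: field_simps)
          ultimately have "F (t + d) = F d + d / (1 + d) * E (t / d * (1 + d))" by simp
          then have "t / (t + d) * F (t + d) = t / (t + d) * F d + t / (t + d) * (d / (1 + d) * E (t / d * (1 + d)))"
            by (simp add: distrib_left)
          also have "\<bar>\<dots>\<bar> \<le> \<bar>t / (t + d) * F d\<bar> + \<bar>t / (t + d)\<bar> * \<bar>d / (1 + d) * E (t / d * (1 + d))\<bar>"
            by (metis abs_mult abs_triangle_ineq)
          also have "\<dots> \<le> \<bar>t / (t + d) * F d\<bar> + 1 * \<bar>d / (1 + d) * E (t / d * (1 + d))\<bar>"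
            using that dpos by (intro add_left_mono mult_right_mono) auto
          finally show ?thesis by simp
        qed
        have "filterlim (\<lambda>t. t / d * (1 + d)) (at_right 0) (at_right 0)"
          using dpos by real_asymp
        then have "((\<lambda>t. E (t / d * (1 + d))) \<longlongrightarrow> 0) (at_right 0)"
          using E0 filterlim_compose by blast
        moreover have "((\<lambda>t. t / (t + d) * F d) \<longlongrightarrow> 0) (at_right 0)"
          using dpos by real_asymp
        ultimately have "((\<lambda>t. \<bar>t / (t + d) * F d\<bar> + \<bar>d / (1 + d) * E (t / d * (1 + d))\<bar>)
            \<longlongrightarrow> \<bar>0\<bar> + \<bar>d / (1 + d) * 0\<bar>) (at_right 0)"
          by (intro tendsto_intros)
        then have lim: "((\<lambda>t. \<bar>t / (t + d) * F d\<bar> + \<bar>d / (1 + d) * E (t / d * (1 + d))\<bar>)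
            \<longlongrightarrow> 0) (at_right 0)"
          by simp
        show ?thesis
          by (rule Lim_null_comparison[OF _ lim], rule eventually_mono[OF eventually_at_right_less])
            (simp only: real_norm_def bound)
      qed
      from tendsto_diff[OF this E0]
      have lim: "((\<lambda>t. t / (t + d) * F (t + d) - E t) \<longlongrightarrow> 0) (at_right 0)" by simp
      show ?thesis
        by (rule Lim_transform_eventually[OF lim])
          (auto intro!: eventually_mono[OF eventually_at_right_less] simp: eq)
    qed
    then have "(\<lambda>n. u n * N (u n) (u n + d)) \<longlonglongrightarrow> 0"
      using u0 by (rule filterlim_compose)
    then have "(\<lambda>n. \<bar>u n * N (u n) (u n + d)\<bar>) \<longlonglongrightarrow> 0"
      by (rule tendsto_rabs_zero)
    then have "u 0 * \<bar>N (u 0) (u 0 + d)\<bar> \<le> 0"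
      using grow u_pos by (intro LIMSEQ_le_const) (auto simp: abs_mult abs_of_pos)
    then have "N (u 0) (u 0 + d) = 0"
      using u_pos[of 0] by (smt (verit) mult_pos_pos)
    then show ?thesis by (simp add: u_def d_def)
  qed
  \<comment> \<open>\<open>N0\<close> covers only a \<le> b. Comparing both \<open>x\<close> and 1
    with max x 1 ties every quotient to E 1.\<close>
  define k where "k = E 1"
  have "E x / x = F x / x" if "x > 0" for x using N0[of x x] that by (simp add: N_def)
  moreover have "E x / x = F (max x 1) / max x 1" if "x > 0" for x
    using N0[of x "max x 1"] that by (simp add: N_def)
  moreover have "F (max x 1) / max x 1 = E 1 / 1" for x using N0[of 1 "max x 1"] by (simp add: N_def)
  ultimately have "E x / x = k" "F x / x = k" if "x > 0" for x using that by (simp_all add: k_def)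
  then show ?thesis by (intro exI[of _ k]) (auto simp: field_simps)
qed

text \<open>The unknown \<open>H\<close> and \<open>K\<close> are eliminated by letting one variable
  tend to 0: for fixed \<open>b\<close>, continuity of \<open>F\<close> at \<open>b\<close> forces
  \<open>E\<close> to have a limit \<open>B\<close> at 0, and F b = H b + b / (1 + b) * B.
  Subtracting the limits leaves the hypotheses of \<open>affine_of_differences\<close>.\<close>

lemma kummer_functional_equation:
  fixes F E H K :: "real \<Rightarrow> real"
  assumes F: "continuous_on {0<..} F" and E: "continuous_on {0<..} E"
    and eqF: "\<And>a b. a > 0 \<Longrightarrow> b > 0 \<Longrightarrow> F (b * (1 + a)) = H b + b / (1 + b) * E (a * (1 + b))"
    and eqE: "\<And>a b. a > 0 \<Longrightarrow> b > 0 \<Longrightarrow> E (a * (1 + b)) = K a + a / (1 + a) * F (b * (1 + a))"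
  shows "\<exists>A B k. \<forall>x>0. F x = A - k * x \<and> E x = B - k * x"
proof -
  \<comment> \<open>Stated for an abstract pair because it serves both equations, with
    \<open>a\<close> and \<open>b\<close> exchanged the second time.\<close>
  have lim: "\<exists>L. (G' \<longlongrightarrow> L) (at_right 0) \<and> (\<forall>b>0. G b = M b + b / (1 + b) * L)"
    if G: "continuous_on {0<..} G"
      and eq: "\<And>a b. a > 0 \<Longrightarrow> b > 0 \<Longrightarrow> G (b * (1 + a)) = M b + b / (1 + b) * G' (a * (1 + b))"
    for G G' M :: "real \<Rightarrow> real"
  proof -
    have lim: "(G' \<longlongrightarrow> (1 + b) / b * (G b - M b)) (at_right 0)" if b: "b > 0" for b
    proof -
      have "isCont G b" using G b by (simp add: continuous_on_eq_continuous_at)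
      moreover have "((\<lambda>a. b * (1 + a / (1 + b))) \<longlongrightarrow> b * (1 + 0 / (1 + b))) (at_right 0)"
        using b by (intro tendsto_intros) auto
      ultimately have "((\<lambda>a. G (b * (1 + a / (1 + b)))) \<longlongrightarrow> G b) (at_right 0)"
        by (intro isCont_tendsto_compose[of b G]) auto
      then have lim: "((\<lambda>a. (1 + b) / b * (G (b * (1 + a / (1 + b))) - M b)) \<longlongrightarrow> (1 + b) / b * (G b - M b)) (at_right 0)"
        by (intro tendsto_intros)
      have eq': "(1 + b) / b * (G (b * (1 + a / (1 + b))) - M b) = G' a" if a: "a > 0" for a
      proof -
        have "a / (1 + b) * (1 + b) = a" "(1 + b) / b * (b / (1 + b) * G' a) = G' a" using b by simp_all
        with eq[of "a / (1 + b)" b] a b show ?thesis by simp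
      qed
      show ?thesis
        by (rule Lim_transform_eventually[OF lim])
          (rule eventually_mono[OF eventually_at_right_less], rule eq')
    qed
    define L where "L = 2 * (G 1 - M 1)"
    have L: "(G' \<longlongrightarrow> L) (at_right 0)" using lim[of 1] by (simp add: L_def)
    moreover have "G b = M b + b / (1 + b) * L" if "b > 0" for b
    proof -
      have "L = (1 + b) / b * (G b - M b)" using L lim[OF that] by (rule tendsto_unique[rotated]) simp
      then show ?thesis using that by (simp add: field_simps)
    qed
    ultimately show ?thesis by blast
  qed
  obtain B where B: "(E \<longlongrightarrow> B) (at_right 0)" "\<And>b. b > 0 \<Longrightarrow> F b = H b + b / (1 + b) * B"
    using lim[OF F eqF] by blast
  obtain A where A: "(F \<longlongrightarrow> A) (at_right 0)" "\<And>a. a > 0 \<Longrightarrow> E a = K a + a / (1 + a) * A"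
    using lim[OF E, where M = K and G' = F] eqE by (metis mult.commute)
  have "\<exists>k. \<forall>x>0. F x - A = k * x \<and> E x - B = k * x"
  proof (rule affine_of_differences)
    show "((\<lambda>x. F x - A) \<longlongrightarrow> 0) (at_right 0)" "((\<lambda>x. E x - B) \<longlongrightarrow> 0) (at_right 0)"
      using A(1) B(1) by (simp_all add: LIM_zero)
    fix a b :: real assume ab: "a > 0" "b > 0"
    show "(F (b * (1 + a)) - A) - (F b - A) = b / (1 + b) * (E (a * (1 + b)) - B)"
      using eqF[OF ab] B(2)[OF ab(2)] by (simp add: right_diff_distrib)
    show "(E (a * (1 + b)) - B) - (E a - B) = a / (1 + a) * (F (b * (1 + a)) - A)"
      using eqE[OF ab] A(2)[OF ab(1)] by (simp add: right_diff_distrib)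
  qed
  then obtain k where "\<And>x. x > 0 \<Longrightarrow> F x - A = k * x \<and> E x - B = k * x" by blast
  then show ?thesis by (intro exI[of _ A] exI[of _ B] exI[of _ "- k"]) (auto simp: algebra_simps)
qed

section \<open>Rooted trees\<close>

text \<open>If the new first vertex already lies on the walk, the walk is cut at that occurrence.
  The bound by the range of \<open>R\<close> later confines the path to a ball.\<close>

lemma distinct_walk:
  assumes "(a, b) \<in> R\<^sup>*"
  shows "\<exists>vs. vs \<noteq> [] \<and> hd vs = a \<and> last vs = b \<and> distinct vs \<and>
    successively (\<lambda>u v. (u, v) \<in> R) vs \<and> set vs \<subseteq> insert a (Range R)"
  using assms
proof (induction rule: converse_rtrancl_induct)
  case base
  show ?case by (intro exI[of _ "[b]"]) auto
next
  case (step a a')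
  then obtain vs where vs: "vs \<noteq> []" "hd vs = a'" "last vs = b" "distinct vs"
    "successively (\<lambda>u v. (u, v) \<in> R) vs" "set vs \<subseteq> insert a' (Range R)" by blast
  have sub: "set vs \<subseteq> insert a (Range R)" using vs step by auto
  show ?case
  proof (cases "a \<in> set vs")
    case True
    then obtain ys zs where "vs = ys @ a # zs" by (meson split_list)
    with vs sub show ?thesis
      by (intro exI[of _ "a # zs"]) (auto simp: successively_append_iff)
  next
    case False
    with vs sub step(1) show ?thesis
      by (intro exI[of _ "a # vs"]) (auto simp: successively_Cons)
  qed
qed

locale finite_tree =
  fixes E :: "'v::finite set set"
  assumes tree: "is_tree (UNIV :: 'v set) E"
begin

abbreviation dist_from :: "'v \<Rightarrow> 'v \<Rightarrow> nat" where
  "dist_from \<equiv> graph_dist E"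

abbreviation nbrs :: "'v \<Rightarrow> 'v set" where
  "nbrs i \<equiv> {j. {i, j} \<in> E}"

lemma edge_neq: "{i, j} \<in> E \<Longrightarrow> i \<noteq> j"
  using tree unfolding is_tree_def by fastforce

lemma no_cycle: "\<not> graph_cycle E vs"
  using tree unfolding is_tree_def by blast

lemma sym_adj: "sym (adj_rel E)"
  by (auto simp: sym_def adj_rel_def insert_commute)

lemma connected: "(u, v) \<in> (adj_rel E)\<^sup>*"
  using tree unfolding is_tree_def connected_graph_def by blast

lemma dist_walk: "(u, v) \<in> adj_rel E ^^ dist_from u v"
proof -
  obtain n where "(u, v) \<in> adj_rel E ^^ n"
    using connected[of u v] by (meson rtrancl_imp_relpow)
  then show ?thesis unfolding graph_dist_def by (rule LeastI)
qed

lemma dist_le: "(u, v) \<in> adj_rel E ^^ n \<Longrightarrow> dist_from u v \<le> n"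
  unfolding graph_dist_def by (rule Least_le)

lemma dist_self [simp]: "dist_from r r = 0"
  using dist_le[of r r 0] by simp

lemma dist_eq_0_iff [simp]: "dist_from r v = 0 \<longleftrightarrow> v = r"
  using dist_walk[of r v] by auto

lemma dist_edge_le: "{i, j} \<in> E \<Longrightarrow> dist_from r j \<le> dist_from r i + 1"
  using dist_walk[of r i] by (intro dist_le) (auto simp: adj_rel_def)

lemma dist_commute: "dist_from u v = dist_from v u"
proof -
  have sym: "(v, u) \<in> adj_rel E ^^ n" if "(u, v) \<in> adj_rel E ^^ n" for u v n
    using that
  proof (induction n arbitrary: v)
    case (Suc n)
    then obtain w where "(u, w) \<in> adj_rel E ^^ n" "(w, v) \<in> adj_rel E" by auto
    with Suc.IH sym_adj show ?case by (meson relpow_Suc_I2 symD)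
  qed simp
  have "dist_from v u \<le> dist_from u v" for u v
    using sym[OF dist_walk] by (rule dist_le)
  then show ?thesis by (simp add: antisym)
qed

lemma ex_pred:
  assumes "v \<noteq> r"
  shows "\<exists>u. {u, v} \<in> E \<and> dist_from r v = dist_from r u + 1"
proof -
  obtain n where n: "dist_from r v = Suc n"
    using assms dist_eq_0_iff[of r v] by (metis not0_implies_Suc)
  with dist_walk[of r v] obtain u where u: "(r, u) \<in> adj_rel E ^^ n" "{u, v} \<in> E"
    by (auto simp: adj_rel_def)
  with dist_le[OF u(1)] dist_edge_le[OF u(2), of r] n show ?thesis by auto
qed

text \<open>Predecessors are closer to \<open>r\<close>, so each of the two vertices is joined to
  \<open>r\<close> inside the ball. Paths confined to a ball are what can be closed to a cycle by
  vertices outside it.\<close>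

lemma ball_connected:
  assumes "dist_from r a < n" "dist_from r b < n"
  defines "R \<equiv> {(u, v). {u, v} \<in> E \<and> dist_from r u < n \<and> dist_from r v < n}"
  shows "(a, b) \<in> R\<^sup>*"
proof -
  have root: "(r, w) \<in> R\<^sup>*" if "dist_from r w < n" for w
    using that
  proof (induction "dist_from r w" arbitrary: w)
    case (Suc m)
    then obtain u where u: "{u, w} \<in> E" "dist_from r w = dist_from r u + 1"
      using ex_pred[of w r] by fastforce
    with Suc have "(r, u) \<in> R\<^sup>*" "(u, w) \<in> R" by (auto simp: R_def)
    then show ?case by simp
  qed simp
  have "sym R" by (auto simp: sym_def R_def insert_commute)
  then have "(a, r) \<in> R\<^sup>*" using root[OF assms(1)] by (meson sym_rtrancl symD)
  with root[OF assms(2)] show ?thesis by simp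
qed

lemma ball_path:
  assumes "dist_from r a < n" "dist_from r b < n"
  obtains vs where "vs \<noteq> []" "hd vs = a" "last vs = b" "distinct vs"
    "successively (\<lambda>u v. {u, v} \<in> E) vs" "\<And>w. w \<in> set vs \<Longrightarrow> dist_from r w < n"
proof -
  define R where "R = {(u, v). {u, v} \<in> E \<and> dist_from r u < n \<and> dist_from r v < n}"
  from ball_connected[OF assms] have "(a, b) \<in> R\<^sup>*" by (simp add: R_def)
  from distinct_walk[OF this] obtain vs where vs: "vs \<noteq> []" "hd vs = a" "last vs = b" "distinct vs"
    "successively (\<lambda>u v. (u, v) \<in> R) vs" "set vs \<subseteq> insert a (Range R)" by blast
  show thesis
  proof (rule that[OF vs(1-4)])
    show "successively (\<lambda>u v. {u, v} \<in> E) vs"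
      using vs(5) by (rule successively_mono) (auto simp: R_def)
    show "dist_from r w < n" if "w \<in> set vs" for w
      using that vs(6) assms by (auto simp: R_def)
  qed
qed

text \<open>Two distinct predecessors are joined by a path of vertices strictly closer to
  \<open>r\<close> than \<open>v\<close>; together with \<open>v\<close> it would be a
  cycle.\<close>

lemma pred_unique:
  assumes "{u, v} \<in> E" "{u', v} \<in> E"
    and "dist_from r v = dist_from r u + 1" "dist_from r v = dist_from r u' + 1"
  shows "u = u'"
proof (rule ccontr)
  assume neq: "u \<noteq> u'"
  obtain vs where vs: "vs \<noteq> []" "hd vs = u" "last vs = u'" "distinct vs"
    "successively (\<lambda>u v. {u, v} \<in> E) vs" "\<And>w. w \<in> set vs \<Longrightarrow> dist_from r w < dist_from r v"
    using ball_path[of r u "dist_from r v" u'] assms by auto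
  have "length vs \<ge> 2"
    using vs(1-3) neq by (cases vs rule: list.exhaust; cases "tl vs") auto
  moreover have "v \<notin> set vs" using vs(6) by blast
  ultimately have "graph_cycle E (v # vs)"
    using vs assms by (auto simp: graph_cycle_def successively_Cons insert_commute)
  with no_cycle show False by blast
qed

text \<open>Were the distances equal, a path joining predecessors of \<open>u\<close> and
  \<open>v\<close> inside the smaller ball (possibly a single vertex) would close up through the
  edge \<open>{u, v}\<close>.\<close>

lemma edge_dist_neq:
  assumes "{u, v} \<in> E"
  shows "dist_from r u \<noteq> dist_from r v"
proof
  assume eq: "dist_from r u = dist_from r v"
  have "u \<noteq> v" using assms by (rule edge_neq)
  then have "u \<noteq> r" "v \<noteq> r" using eq by (metis dist_eq_0_iff dist_self)+
  then obtain a b where ab: "{a, u} \<in> E" "dist_from r u = dist_from r a + 1"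
    "{b, v} \<in> E" "dist_from r v = dist_from r b + 1" using ex_pred by metis
  obtain vs where vs: "vs \<noteq> []" "hd vs = a" "last vs = b" "distinct vs"
    "successively (\<lambda>u v. {u, v} \<in> E) vs" "\<And>w. w \<in> set vs \<Longrightarrow> dist_from r w < dist_from r v"
    using ball_path[of r a "dist_from r v" b] ab eq by auto
  have "u \<notin> set vs" "v \<notin> set vs" using vs(6) eq by fastforce+
  then have "graph_cycle E (u # vs @ [v])"
    using vs ab eq assms \<open>u \<noteq> v\<close>
    by (auto simp: graph_cycle_def successively_Cons successively_append_iff insert_commute
        Suc_le_eq numeral_eq_Suc)
  with no_cycle show False by blast
qed

lemma edge_dist_cases:
  assumes "{i, j} \<in> E"
  shows "dist_from r i = dist_from r j + 1 \<or> dist_from r j = dist_from r i + 1"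
proof -
  have "{j, i} \<in> E" using assms by (simp add: insert_commute)
  then show ?thesis
    using edge_dist_neq[OF assms, of r] dist_edge_le[OF assms, of r] dist_edge_le[of j i r] by linarith
qed

lemma in_children_iff: "j \<in> children E r i \<longleftrightarrow> {i, j} \<in> E \<and> dist_from r j = dist_from r i + 1"
  by (simp add: children_def)

lemma children_parent: "j \<in> children E r i \<Longrightarrow> parent E r j = i"
  unfolding parent_def by (rule the_equality) (auto simp: in_children_iff intro: pred_unique)

lemma children_ne_root: "j \<in> children E r i \<Longrightarrow> j \<noteq> r"
  by (auto simp: in_children_iff)

lemma parent_child: "i \<noteq> r \<Longrightarrow> i \<in> children E r (parent E r i)"
  using ex_pred[of i r] children_parent[of i r] by (auto simp: in_children_iff)

lemma children_iff_parent: "j \<in> children E r i \<longleftrightarrow> j \<noteq> r \<and> parent E r j = i"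
  using parent_child[of j r] children_parent[of j r i] children_ne_root[of j r i] by auto

lemma parent_edge: "i \<noteq> r \<Longrightarrow> {parent E r i, i} \<in> E"
  using parent_child[of i r] by (simp add: in_children_iff)

lemma parent_ne: "i \<noteq> r \<Longrightarrow> parent E r i \<noteq> i"
  using parent_edge[of i r] edge_neq[of "parent E r i" i] by simp

lemma children_nonroot: "i \<noteq> r \<Longrightarrow> children E r i = nbrs i - {parent E r i}"
proof (intro set_eqI)
  fix j assume i: "i \<noteq> r"
  show "j \<in> children E r i \<longleftrightarrow> j \<in> nbrs i - {parent E r i}"
    using parent_child[OF i] edge_dist_cases[of i j r] children_parent[of i r j]
    by (auto simp: in_children_iff insert_commute)
qed

lemma children_root: "children E r r = nbrs r"
proof -
  have "dist_from r j = 1" if "{r, j} \<in> E" for j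
    using edge_dist_cases[OF that, of r] by simp
  then show ?thesis by (auto simp: in_children_iff)
qed

lemma nbrs_parent: "i \<noteq> r \<Longrightarrow> nbrs i = insert (parent E r i) (children E r i)"
proof -
  assume i: "i \<noteq> r"
  then have "{i, parent E r i} \<in> E" using parent_edge[OF i] by (simp add: insert_commute)
  then show ?thesis unfolding children_nonroot[OF i] by blast
qed

lemma parent_nbr: "{i, j} \<in> E \<Longrightarrow> parent E j i = j"
  by (rule children_parent) (simp add: children_root insert_commute)

lemma vdegree_card: "vdegree E v = card (nbrs v)"
proof -
  have "{e \<in> E. v \<in> e} = (\<lambda>j. {v, j}) ` nbrs v"
  proof (intro set_eqI iffI)
    fix e assume e: "e \<in> {e \<in> E. v \<in> e}"
    then have "card e = 2" using tree by (auto simp: is_tree_def)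
    with e show "e \<in> (\<lambda>j. {v, j}) ` nbrs v" by (auto simp: card_2_iff insert_commute)
  qed auto
  then show ?thesis unfolding vdegree_def by (simp add: card_image inj_on_def doubleton_eq_iff)
qed

text \<open>Among the vertices closer to \<open>j\<close> than to \<open>i\<close>, one farthest
  from \<open>i\<close> has no children as seen from \<open>i\<close>: a child would lie on the same
  side and still farther away. Its parent is then its only neighbour.\<close>

lemma leaf_behind_edge:
  assumes "{i, j} \<in> E"
  shows "\<exists>r. is_leaf E r \<and> i \<noteq> r \<and> parent E r i = j"
proof -
  define S where "S = {r. dist_from r i = dist_from r j + 1}"
  have "j \<in> S"
    using assms edge_dist_cases[OF assms, of j] by (auto simp: S_def)
  then have "Max (dist_from i ` S) \<in> dist_from i ` S" by (intro Max_in) auto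
  then obtain r where "r \<in> S" "dist_from i r = Max (dist_from i ` S)" by auto
  then have r: "r \<in> S" "\<And>k. k \<in> S \<Longrightarrow> dist_from i k \<le> dist_from i r" by auto
  have ir: "i \<noteq> r" "r \<noteq> i" using r(1) by (auto simp: S_def)
  have par: "parent E r i = j"
    using r(1) assms by (intro children_parent) (simp add: in_children_iff S_def insert_commute)
  have "children E i r = {}"
  proof (rule ccontr)
    assume "children E i r \<noteq> {}"
    then obtain k where k: "{r, k} \<in> E" "dist_from i k = dist_from i r + 1"
      by (auto simp: in_children_iff)
    have "dist_from k j \<le> dist_from r j + 1"
      using dist_edge_le[OF k(1), of j] by (simp add: dist_commute)
    also have "\<dots> = dist_from k i - 1" using r(1) k(2) by (simp add: S_def dist_commute)
    finally have "dist_from k j < dist_from k i" using k(2) by (simp add: dist_commute)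
    then have "k \<in> S" using edge_dist_cases[OF assms, of k] by (auto simp: S_def)
    with r(2) k(2) show False by fastforce
  qed
  then have "nbrs r = {parent E i r}" using nbrs_parent[OF ir(2)] by simp
  then have "is_leaf E r" by (simp add: is_leaf_def vdegree_card)
  with ir par show ?thesis by blast
qed

text \<open>Every vertex other than \<open>r\<close> is a child of exactly one vertex, so both sides
  are products over the edges, indexed on the right by the lower endpoint.\<close>

lemma prod_children:
  fixes h :: "'v \<Rightarrow> 'v \<Rightarrow> 'a::comm_monoid_mult"
  shows "(\<Prod>i\<in>UNIV. \<Prod>j\<in>children E r i. h i j) = (\<Prod>j\<in>-{r}. h (parent E r j) j)"
proof -
  have "(\<Prod>j\<in>-{r}. h (parent E r j) j) = (\<Prod>i\<in>UNIV. \<Prod>j\<in>{j \<in> -{r}. parent E r j = i}. h (parent E r j) j)"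
    by (rule prod.group[symmetric]) auto
  also have "\<dots> = (\<Prod>i\<in>UNIV. \<Prod>j\<in>children E r i. h i j)"
    by (intro prod.cong) (auto simp: children_iff_parent)
  finally show ?thesis by simp
qed

end

section \<open>The transformation and its inverse\<close>

definition vupd :: "'a ^ 'v \<Rightarrow> 'v::finite \<Rightarrow> 'a \<Rightarrow> 'a ^ 'v" where
  "vupd s i t = (\<chi> k. if k = i then t else s $ k)"

lemma vupd_nth [simp]: "vupd s i t $ k = (if k = i then t else s $ k)"
  by (simp add: vupd_def)

lemma vupd_same [simp]: "vupd s i (s $ i) = s"
  by (simp add: vec_eq_iff)

lemma vupd_vupd [simp]: "vupd (vupd s i t) i u = vupd s i u"
  by (simp add: vec_eq_iff)

lemma vupd_pos: "s \<in> pos_orthant \<Longrightarrow> t > 0 \<Longrightarrow> vupd s i t \<in> pos_orthant"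
  by (simp add: pos_orthant_def)

locale weighted_tree = finite_tree E for E :: "'v::finite set set" +
  fixes C :: "real ^ 'v ^ 'v"
  assumes C: "C \<in> tree_matrices E"
begin

definition ratio :: "'v \<Rightarrow> 'v \<Rightarrow> real" where
  "ratio i j = C $ i $ j / C $ i $ i"

abbreviation comp :: "'v \<Rightarrow> real ^ 'v \<Rightarrow> 'v \<Rightarrow> real" where
  "comp \<equiv> Phi_comp E C"

lemma C_diag: "C $ i $ i > 0"
  using C by (simp add: tree_matrices_def)

lemma C_edge: "{i, j} \<in> E \<Longrightarrow> C $ i $ j > 0"
  using C by (simp add: tree_matrices_def)

lemma C_sym: "C $ i $ j = C $ j $ i"
proof -
  have "transpose C $ j $ i = C $ j $ i" using C by (simp add: tree_matrices_def)
  then show ?thesis by (simp add: transpose_def)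
qed

lemma ratio_pos: "{i, j} \<in> E \<Longrightarrow> ratio i j > 0"
  using C_edge C_diag by (simp add: ratio_def)

lemma ratio_child: "j \<in> children E r i \<Longrightarrow> ratio i j > 0"
  by (rule ratio_pos) (simp add: in_children_iff)

lemma comp_rec: "comp r x i = x $ i * (\<Prod>j\<in>children E r i. 1 + ratio i j * comp r x j)"
  unfolding ratio_def by (rule Phi_comp.simps)

lemma children_induct [case_names step]:
  assumes "\<And>i. (\<And>j. j \<in> children E r i \<Longrightarrow> P j) \<Longrightarrow> P i"
  shows "P i"
proof -
  have "P i" if "dist_from r i = Max (range (dist_from r)) - n" for n
    using that
  proof (induction n arbitrary: i rule: less_induct)
    case (less n)
    show ?case
    proof (rule assms)
      fix j assume "j \<in> children E r i"
      then have j: "dist_from r j = dist_from r i + 1" by (simp add: in_children_iff)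
      moreover have "dist_from r j \<le> Max (range (dist_from r))" by (rule Max_ge) auto
      ultimately show "P j"
        using less.prems by (intro less.IH[of "Max (range (dist_from r)) - dist_from r j"]) auto
    qed
  qed
  from this[of "Max (range (dist_from r)) - dist_from r i"] show ?thesis
    by (simp add: Max_ge)
qed

lemma comp_pos: "x \<in> pos_orthant \<Longrightarrow> comp r x i > 0"
proof (induction i rule: children_induct[of r])
  case (step i)
  then show ?case
    by (subst comp_rec) (auto simp: pos_orthant_def intro!: mult_pos_pos prod_pos add_pos_pos ratio_child)
qed

lemma Phi_nth [simp]: "Phi E C r x $ i = comp r x i"
  by (simp add: Phi_def)

lemma Phi_pos: "x \<in> pos_orthant \<Longrightarrow> Phi E C r x \<in> pos_orthant"
  using comp_pos by (simp add: pos_orthant_def)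

lemma continuous_comp: "continuous_on UNIV (\<lambda>x. comp r x i)"
proof (induction i rule: children_induct[of r])
  case (step i)
  have "continuous_on UNIV (\<lambda>x. x $ i * (\<Prod>j\<in>children E r i. 1 + ratio i j * comp r x j))"
    by (intro continuous_intros step)
  then show ?case by (simp only: comp_rec[symmetric])
qed

lemma measurable_Phi [measurable]: "Phi E C r \<in> borel_measurable borel"
proof (rule borel_measurable_continuous_onI)
  show "continuous_on UNIV (Phi E C r)"
    unfolding Phi_def by (intro continuous_on_vec_lambda continuous_comp)
qed

text \<open>The absolute value only matters outside the orthant: it makes each coordinate a positive
  multiple of the old one, so that the orthant and its complement are both preserved.\<close>

definition den :: "'v \<Rightarrow> real ^ 'v \<Rightarrow> 'v \<Rightarrow> real" where
  "den r s i = (\<Prod>j\<in>children E r i. 1 + ratio i j * \<bar>s $ j\<bar>)"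

definition Psi :: "'v \<Rightarrow> real ^ 'v \<Rightarrow> real ^ 'v" where
  "Psi r s = (\<chi> i. s $ i / den r s i)"

lemma den_pos: "den r s i > 0"
  unfolding den_def
proof (rule prod_pos)
  fix j assume "j \<in> children E r i"
  then show "0 < 1 + ratio i j * \<bar>s $ j\<bar>"
    using ratio_child[of j r i] by (simp add: add_pos_nonneg)
qed

lemma Psi_nth [simp]: "Psi r s $ i = s $ i / den r s i"
  by (simp add: Psi_def)

lemma Psi_pos_iff: "Psi r s \<in> pos_orthant \<longleftrightarrow> s \<in> pos_orthant"
proof -
  have "0 < s $ i / den r s i \<longleftrightarrow> 0 < s $ i" for i
    using den_pos[of r s i] by (auto simp: zero_less_divide_iff)
  then show ?thesis by (simp add: pos_orthant_def)
qed

lemma Psi_pos: "s \<in> pos_orthant \<Longrightarrow> Psi r s \<in> pos_orthant"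
  by (simp add: Psi_pos_iff)

lemma comp_Psi: "s \<in> pos_orthant \<Longrightarrow> comp r (Psi r s) i = s $ i"
proof (induction i rule: children_induct[of r])
  case (step i)
  have "(\<Prod>j\<in>children E r i. 1 + ratio i j * comp r (Psi r s) j) = den r s i"
    unfolding den_def using step by (intro prod.cong) (auto simp: pos_orthant_def abs_of_pos)
  then show ?case using den_pos[of r s i] by (subst comp_rec) simp
qed

lemma Phi_Psi: "s \<in> pos_orthant \<Longrightarrow> Phi E C r (Psi r s) = s"
  by (simp add: vec_eq_iff comp_Psi)

lemma Psi_Phi: "x \<in> pos_orthant \<Longrightarrow> Psi r (Phi E C r x) = x"
proof -
  assume x: "x \<in> pos_orthant"
  have "comp r x i / den r (Phi E C r x) i = x $ i" for i
  proof -
    have "den r (Phi E C r x) i = (\<Prod>j\<in>children E r i. 1 + ratio i j * comp r x j)"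
      unfolding den_def using comp_pos[OF x] by (intro prod.cong) (auto simp: abs_of_pos)
    then have "comp r x i = x $ i * den r (Phi E C r x) i" using comp_rec[of r x i] by simp
    then show ?thesis using den_pos[of r "Phi E C r x" i] by simp
  qed
  then show ?thesis by (simp add: vec_eq_iff)
qed

text \<open>Once its parent is removed, \<open>i\<close> has the same neighbours below it for both
  roots, and the recursion for the message only looks below \<open>i\<close>.\<close>

lemma comp_parent_cong:
  assumes "i \<noteq> r" "i \<noteq> r'" "parent E r i = parent E r' i"
  shows "comp r x i = comp r' x i"
  using assms
proof (induction i rule: children_induct[of r])
  case (step i)
  have ch: "children E r i = children E r' i"
    using step.prems by (simp add: children_nonroot)
  have "comp r x j = comp r' x j" if "j \<in> children E r i" for j
    using that ch step.IH[OF that] children_ne_root[of j _ i] children_parent[of j _ i] by auto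
  then show ?case by (subst (1 2) comp_rec) (simp add: ch)
qed

text \<open>Taking \<open>i\<close> itself as root adds the single child \<open>j\<close> to those
  that \<open>i\<close> has under root \<open>j\<close>; the messages of the other children do not
  change.\<close>

lemma comp_root_edge:
  assumes "{i, j} \<in> E"
  shows "comp i x i = comp j x i * (1 + ratio i j * comp i x j)"
proof -
  have ij: "i \<noteq> j" using assms by (rule edge_neq)
  have par: "parent E j i = j" using assms by (rule parent_nbr)
  have ch: "children E i i = insert j (children E j i)"
    using children_root[of i] nbrs_parent[OF ij] par by simp
  have nin: "j \<notin> children E j i" using children_ne_root by blast
  have "comp i x k = comp j x k" if "k \<in> children E j i" for k
  proof (rule comp_parent_cong)
    have "k \<in> children E i i" using ch that by simp
    then show "k \<noteq> i" "k \<noteq> j" "parent E i k = parent E j k"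
      using that children_ne_root[of k i i] children_ne_root[of k j i]
        children_parent[of k i i] children_parent[of k j i] by auto
  qed
  then have "(\<Prod>k\<in>children E j i. 1 + ratio i k * comp i x k) =
      (\<Prod>k\<in>children E j i. 1 + ratio i k * comp j x k)" by simp
  then show ?thesis
    by (subst comp_rec[of i x i], subst comp_rec[of j x i]) (simp add: ch nin)
qed

lemma comp_parent_nbr:
  assumes "i \<noteq> r"
  shows "comp r x i = comp (parent E r i) x i"
proof (rule comp_parent_cong)
  show "i \<noteq> parent E r i" using parent_ne[OF assms] by simp
  have "{i, parent E r i} \<in> E" using parent_edge[OF assms] by (simp add: insert_commute)
  then show "parent E r i = parent E (parent E r i) i" by (simp add: parent_nbr)
qed (rule assms)

end

section \<open>The exponent of the tree-Kummer density\<close>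

context weighted_tree
begin

definition induced :: "'v set \<Rightarrow> 'v set set" where
  "induced W = {e \<in> E. e \<subseteq> W}"

text \<open>A subtree is determined by its vertex set and inherits acyclicity from \<open>E\<close>,
  so connectedness is the only graph condition.\<close>

definition subtree_sets :: "'v set set" where
  "subtree_sets = {W. W \<noteq> {} \<and> connected_graph W (induced W)}"

definition weight :: "real ^ 'v \<Rightarrow> 'v set \<Rightarrow> real" where
  "weight x W = (\<Prod>i\<in>W. x $ i / (C $ i $ i) powi (int (vdegree (induced W) i) - 1)) *
     (\<Prod>e\<in>induced W. edge_entry C e)"

lemma is_tree_induced: "is_tree W (induced W) \<longleftrightarrow> W \<in> subtree_sets"
proof -
  have "\<not> graph_cycle (induced W) vs" for vs
  proof
    assume "graph_cycle (induced W) vs"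
    then have "graph_cycle E vs"
      unfolding graph_cycle_def by (auto simp: induced_def elim: successively_mono)
    then show False using no_cycle by blast
  qed
  moreover have "\<forall>e\<in>induced W. e \<subseteq> W \<and> card e = 2"
    using tree by (auto simp: induced_def is_tree_def)
  ultimately show ?thesis by (auto simp: is_tree_def subtree_sets_def)
qed

lemma exponent_weight: "tree_kummer_exponent E C x = (\<Sum>W\<in>subtree_sets. weight x W)"
proof -
  have "subtrees UNIV E = (\<lambda>W. (W, induced W)) ` subtree_sets"
    by (auto simp: subtrees_def is_tree_induced[symmetric] simp flip: induced_def)
      (auto simp: is_tree_def)
  then show ?thesis
    unfolding tree_kummer_exponent_def
    by (simp add: sum.reindex inj_on_def weight_def)
qed

lemma edge_entry_edge: "edge_entry C {j, k} = C $ j $ k"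
  unfolding edge_entry_def
  by (rule the_equality) (auto simp: doubleton_eq_iff C_sym)

lemma connected_attach:
  assumes l: "l \<notin> W" and q: "q \<in> W" "{q, l} \<in> E" and only: "\<And>k. k \<in> W \<Longrightarrow> {k, l} \<in> E \<Longrightarrow> k = q"
  shows "connected_graph (insert l W) (induced (insert l W)) \<longleftrightarrow> connected_graph W (induced W)"
proof
  \<comment> \<open>Collapsing \<open>l\<close> to its only neighbour \<open>q\<close> in
    \<open>W\<close> turns a walk in \<open>insert l W\<close> into one in \<open>W\<close>: each
    step becomes an edge or a repetition.\<close>
  define f where "f k = (if k = l then q else k)" for k
  assume conn: "connected_graph (insert l W) (induced (insert l W))"
  show "connected_graph W (induced W)"
    unfolding connected_graph_def
  proof (intro ballI)
    fix u v assume uv: "u \<in> W" "v \<in> W"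
    have "(u, v) \<in> (adj_rel (induced (insert l W)))\<^sup>*"
      using conn uv by (auto simp: connected_graph_def)
    then have "(f u, f v) \<in> (adj_rel (induced W))\<^sup>*"
    proof (induction rule: rtrancl_induct)
      case (step a b)
      have ab: "{a, b} \<in> E" "a \<in> insert l W" "b \<in> insert l W" "a \<noteq> b"
        using step(2) edge_neq by (auto simp: adj_rel_def induced_def)
      have "f a = f b \<or> (f a, f b) \<in> adj_rel (induced W)"
        using ab only[of a] only[of b]
        by (auto simp: f_def adj_rel_def induced_def insert_commute)
      with step.IH show ?case by (auto intro: rtrancl_into_rtrancl)
    qed simp
    moreover have "f u = u" "f v = v" using uv l by (auto simp: f_def)
    ultimately show "(u, v) \<in> (adj_rel (induced W))\<^sup>*" by simp
  qed
next
  assume conn: "connected_graph W (induced W)"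
  let ?R = "adj_rel (induced (insert l W))"
  have sub: "adj_rel (induced W) \<subseteq> ?R" by (auto simp: adj_rel_def induced_def)
  have inner: "(u, v) \<in> ?R\<^sup>*" if "u \<in> W" "v \<in> W" for u v
  proof -
    have "(u, v) \<in> (adj_rel (induced W))\<^sup>*" using conn that by (simp add: connected_graph_def)
    then show ?thesis using rtrancl_mono[OF sub] by blast
  qed
  have lq: "(l, q) \<in> ?R" "(q, l) \<in> ?R"
    using q by (auto simp: adj_rel_def induced_def insert_commute)
  show "connected_graph (insert l W) (induced (insert l W))"
    unfolding connected_graph_def
    using inner q lq by (auto intro: converse_rtrancl_into_rtrancl rtrancl_into_rtrancl)
qed

text \<open>The new vertex has degree 1, so C_ll appears with power 0; the degree of
  \<open>q\<close> grows by 1, which divides by C_qq; the new edge contributes C_ql. Together these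
  give the factor \<open>ratio q l * x $ l\<close>.\<close>

lemma weight_attach:
  assumes l: "l \<notin> W" and q: "q \<in> W" "{q, l} \<in> E" and only: "\<And>k. k \<in> W \<Longrightarrow> {k, l} \<in> E \<Longrightarrow> k = q"
  shows "weight x (insert l W) = weight x W * (ratio q l * x $ l)"
proof -
  have card2: "card e = 2" if "e \<in> E" for e using that tree by (auto simp: is_tree_def)
  have new: "e = {q, l}" if e: "e \<in> E" "e \<subseteq> insert l W" "l \<in> e" for e
  proof -
    obtain k where k: "e = {k, l}" using card2[OF e(1)] e(3) by (auto simp: card_2_iff insert_commute)
    then have "k \<noteq> l" using e(1) edge_neq by blast
    then show ?thesis using only[of k] e k by auto
  qed
  have ind: "induced (insert l W) = insert {q, l} (induced W)"
  proof (intro equalityI subsetI)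
    fix e assume "e \<in> induced (insert l W)"
    then have e: "e \<in> E" "e \<subseteq> insert l W" by (auto simp: induced_def)
    show "e \<in> insert {q, l} (induced W)"
    proof (cases "l \<in> e")
      case True
      then show ?thesis using new[OF e] by simp
    next
      case False
      then show ?thesis using e by (auto simp: induced_def)
    qed
  qed (use q in \<open>auto simp: induced_def\<close>)
  have nin: "{q, l} \<notin> induced W" using l by (auto simp: induced_def)
  have deg_l: "vdegree (induced (insert l W)) l = 1"
  proof -
    have "{e \<in> induced (insert l W). l \<in> e} = {{q, l}}"
      unfolding ind using l by (auto simp: induced_def)
    then show ?thesis by (simp add: vdegree_def)
  qed
  have deg: "vdegree (induced (insert l W)) i = vdegree (induced W) i + (if i = q then 1 else 0)"
    if "i \<in> W" for i
  proof -
    have "{e \<in> induced (insert l W). i \<in> e} =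
        (if i = q then insert {q, l} {e \<in> induced W. i \<in> e} else {e \<in> induced W. i \<in> e})"
      unfolding ind using that l by auto
    then show ?thesis using nin by (simp add: vdegree_def)
  qed
  let ?t = "\<lambda>W i. x $ i / (C $ i $ i) powi (int (vdegree (induced W) i) - 1)"
  have "(\<Prod>i\<in>W. ?t (insert l W) i) = (\<Prod>i\<in>W. ?t W i / (if i = q then C $ q $ q else 1))"
  proof (rule prod.cong)
    fix i assume "i \<in> W"
    then show "?t (insert l W) i = ?t W i / (if i = q then C $ q $ q else 1)"
      using deg[of i] C_diag[of i] power_int_add_1[of "C $ i $ i" "int (vdegree (induced W) i) - 1"]
      by (auto simp: algebra_simps)
  qed simp
  also have "\<dots> = (\<Prod>i\<in>W. ?t W i) / C $ q $ q"
    using q by (simp only: prod_dividef) simp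
  finally show ?thesis
    using l nin deg_l
    by (simp add: weight_def ind edge_entry_edge ratio_def)
qed

lemma weight_singleton: "weight x {l} = C $ l $ l * x $ l"
proof -
  have "induced {l} = {}"
    using tree by (auto simp: induced_def is_tree_def subset_singleton_iff)
  then show ?thesis by (simp add: weight_def vdegree_def power_int_minus divide_inverse)
qed

lemma weight_zero: "i \<in> W \<Longrightarrow> x $ i = 0 \<Longrightarrow> weight x W = 0"
  by (auto simp: weight_def prod_zero_iff)

lemma weight_scale_coord:
  assumes "q \<in> W"
  shows "weight (vupd x q (x $ q * t)) W = weight x W * t"
  using assms by (simp add: weight_def prod.remove[of W q])

lemma weight_cong: "(\<And>i. i \<in> W \<Longrightarrow> x $ i = y $ i) \<Longrightarrow> weight x W = weight y W"
  by (simp add: weight_def)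

lemma singleton_subtree: "{l} \<in> subtree_sets"
  by (simp add: subtree_sets_def connected_graph_def)

text \<open>Induction on the support of \<open>x\<close>: a farthest vertex \<open>l\<close> of the support contributes its own
  weight, and its factor in any larger subtree can be absorbed into the coordinate of its parent.\<close>

lemma exponent_eq_sum_comp: "tree_kummer_exponent E C x = (\<Sum>i\<in>UNIV. C $ i $ i * comp r x i)"
proof -
  have "(\<Sum>W\<in>subtree_sets. weight x W) = (\<Sum>i\<in>UNIV. C $ i $ i * comp r x i)"
  proof (induction "card {i. x $ i \<noteq> 0}" arbitrary: x rule: less_induct)
    case less
    define B where "B = {i. x $ i \<noteq> 0}"
    have comp0: "comp r x i = 0" if "i \<notin> B" for i
      using that by (subst comp_rec) (simp add: B_def)
    show ?case
    proof (cases "B = {}")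
      case True
      then have "weight x W = 0" if "W \<in> subtree_sets" for W
        using that weight_zero[of _ W x] by (auto simp: subtree_sets_def B_def)
      with True comp0 show ?thesis by simp
    next
      case False
      then have "Max (dist_from r ` B) \<in> dist_from r ` B" by (intro Max_in) auto
      then obtain l where "l \<in> B" "dist_from r l = Max (dist_from r ` B)" by auto
      then have l: "l \<in> B" "\<And>k. k \<in> B \<Longrightarrow> dist_from r k \<le> dist_from r l" by auto
      have ch: "k \<notin> B" if "k \<in> children E r l" for k
        using l(2)[of k] that by (auto simp: in_children_iff)
      have comp_l: "comp r x l = x $ l"
        using comp0[OF ch] by (subst comp_rec) simp
      show ?thesis
      proof (cases "l = r")
        case True
        have B: "i = l" if "i \<in> B" for i using l(2)[OF that] True by simp
        have "weight x W = 0" if "W \<in> subtree_sets - {{l}}" for W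
        proof -
          have "W \<noteq> {}" "W \<noteq> {l}" using that by (auto simp: subtree_sets_def)
          then obtain i where "i \<in> W" "i \<noteq> l" by blast
          then show ?thesis using B weight_zero[of i W x] by (auto simp: B_def)
        qed
        then have "(\<Sum>W\<in>subtree_sets. weight x W) = weight x {l}"
          using singleton_subtree[of l] by (simp add: sum.remove[of subtree_sets "{l}"])
        moreover have "(\<Sum>i\<in>UNIV. C $ i $ i * comp r x i) = C $ l $ l * comp r x l"
        proof -
          have "comp r x i = 0" if "i \<noteq> l" for i using B comp0 that by blast
          then show ?thesis by (subst sum.remove[of UNIV l]) simp_all
        qed
        ultimately show ?thesis by (simp add: weight_singleton comp_l)
      next
        case False
        define q where "q = parent E r l"
        have q: "{q, l} \<in> E" "q \<noteq> l" "l \<in> children E r q"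
          using parent_edge[OF False] parent_ne[OF False] parent_child[OF False] by (auto simp: q_def)
        \<comment> \<open>The neighbours of \<open>l\<close> are its parent \<open>q\<close> and its
          children; the children are farther from \<open>r\<close>, hence outside the support by the
          choice of \<open>l\<close>.\<close>
        have only: "k = q" if "k \<in> B" "{k, l} \<in> E" for k
        proof -
          have "k \<in> nbrs l" using that by (simp add: insert_commute)
          then show ?thesis using nbrs_parent[OF False] ch that by (auto simp: q_def)
        qed
        define y where "y = vupd x l 0"
        \<comment> \<open>Coordinate \<open>l\<close> is switched off and its factor 1 + ratio q l *
          x_l is moved into coordinate \<open>q\<close>. The support shrinks, and every message
          except the one at \<open>l\<close> is preserved.\<close>
        define x' where "x' = vupd y q (y $ q * (1 + ratio q l * x $ l))"
        have "{i. x' $ i \<noteq> 0} \<subset> {i. x $ i \<noteq> 0}"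
          using l q by (auto simp: x'_def y_def B_def)
        then have IH: "(\<Sum>W\<in>subtree_sets. weight x' W) = (\<Sum>i\<in>UNIV. C $ i $ i * comp r x' i)"
          by (intro less psubset_card_mono) auto
        have comp': "i \<noteq> l \<Longrightarrow> comp r x' i = comp r x i" for i
        proof (induction i rule: children_induct[of r])
          case (step i)
          show ?case
          proof (cases "i = q")
            case True
            let ?P = "\<lambda>x. \<Prod>j\<in>children E r q - {l}. 1 + ratio q j * comp r x j"
            have split: "comp r z q = z $ q * ((1 + ratio q l * comp r z l) * ?P z)" for z
              using q(3) by (subst comp_rec) (simp add: prod.remove)
            have "?P x' = ?P x" using step True by (intro prod.cong) auto
            moreover have "comp r x' l = 0" using q(2) by (subst comp_rec) (simp add: x'_def y_def)
            ultimately show ?thesis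
              unfolding True using q(2) split[of x] split[of x'] comp_l by (simp add: x'_def y_def)
          next
            case False
            then have "l \<notin> children E r i" using q(3) children_parent by blast
            then have "comp r x' j = comp r x j" if "j \<in> children E r i" for j
              using step.IH[OF that] that by auto
            with False step.prems show ?thesis
              by (subst (1 2) comp_rec) (simp add: x'_def y_def)
          qed
        qed
        have compx'l: "comp r x' l = 0" using q(2) by (subst comp_rec) (simp add: x'_def y_def)
        have rhs: "(\<Sum>i\<in>UNIV. C $ i $ i * comp r x i) =
            C $ l $ l * x $ l + (\<Sum>i\<in>UNIV. C $ i $ i * comp r x' i)"
          by (subst (1 2) sum.remove[of UNIV l]) (simp_all add: comp' comp_l compx'l)
        define S0 where "S0 = {W \<in> subtree_sets. l \<notin> W}"
        define S1 where "S1 = {W \<in> subtree_sets. l \<in> W \<and> W \<noteq> {l}}"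
        have decomp: "subtree_sets = insert {l} (S1 \<union> S0)"
          using singleton_subtree by (auto simp: S0_def S1_def)
        have split: "(\<Sum>W\<in>subtree_sets. weight z W) =
            weight z {l} + ((\<Sum>W\<in>S1. weight z W) + (\<Sum>W\<in>S0. weight z W))" for z
        proof -
          have "{l} \<notin> S1 \<union> S0" "S1 \<inter> S0 = {}" by (auto simp: S0_def S1_def)
          then show ?thesis unfolding decomp by (simp add: sum.union_disjoint)
        qed
        have "(\<Sum>W\<in>S1. weight x' W) = 0"
          using q(2) by (intro sum.neutral) (auto simp: S1_def x'_def y_def intro!: weight_zero[of l])
        then have lhs': "(\<Sum>W\<in>subtree_sets. weight x' W) = (\<Sum>W\<in>S0. weight x' W)"
          using split[of x'] q(2) by (simp add: weight_singleton x'_def y_def)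
        have q_in: "q \<in> W" if "W \<in> S1" "W \<subseteq> B" for W
        proof -
          have "l \<in> W" "W \<noteq> {l}" using that by (auto simp: S1_def)
          then obtain v where v: "v \<in> W" "v \<noteq> l" by blast
          have "(l, v) \<in> (adj_rel (induced W))\<^sup>*"
            using that v by (auto simp: S1_def subtree_sets_def connected_graph_def)
          then obtain k where "(l, k) \<in> adj_rel (induced W)"
            using v(2) by (metis converse_rtranclE)
          then have "k \<in> W" "{k, l} \<in> E" by (auto simp: adj_rel_def induced_def insert_commute)
          then show ?thesis using only[of k] that(2) by auto
        qed
        \<comment> \<open>Only subtrees inside the support have nonzero weight. Those in
          \<open>S1\<close> arise by attaching \<open>l\<close> to a member of \<open>T\<close>, so
          their weights supply exactly the extra terms produced by the enlarged coordinate
          \<open>q\<close> of \<open>x'\<close>.\<close>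
        define T where "T = {W \<in> S0. q \<in> W \<and> W \<subseteq> B}"
        have only_T: "k = q" if "W \<in> T" "k \<in> W" "{k, l} \<in> E" for W k
          using that only by (auto simp: T_def)
        have attach: "insert l W \<in> S1" "weight x (insert l W) = weight x W * (ratio q l * x $ l)"
          if "W \<in> T" for W
        proof -
          have W: "l \<notin> W" "q \<in> W" using that by (auto simp: T_def S0_def)
          show "weight x (insert l W) = weight x W * (ratio q l * x $ l)"
            using weight_attach[OF W q(1)] only_T[OF that] by blast
          show "insert l W \<in> S1"
            using connected_attach[OF W q(1)] only_T[OF that] that W q(2)
            by (auto simp: S1_def T_def S0_def subtree_sets_def)
        qed
        have S1B: "{W \<in> S1. W \<subseteq> B} = insert l ` T"
        proof (intro equalityI subsetI)
          fix W assume W: "W \<in> {W \<in> S1. W \<subseteq> B}"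
          define W0 where "W0 = W - {l}"
          have W0: "W = insert l W0" "l \<notin> W0" "q \<in> W0" "W0 \<subseteq> B"
            using W q_in[of W] q(2) by (auto simp: W0_def S1_def)
          have "connected_graph W0 (induced W0)"
            using connected_attach[OF W0(2,3) q(1)] only W0 W by (auto simp: S1_def subtree_sets_def)
          then have "W0 \<in> T" using W0 by (auto simp: T_def S0_def subtree_sets_def)
          then show "W \<in> insert l ` T" using W0(1) by blast
        qed (use attach(1) l(1) in \<open>auto simp: T_def\<close>)
        have "(\<Sum>W\<in>S1. weight x W) = (\<Sum>W\<in>{W \<in> S1. W \<subseteq> B}. weight x W)"
          by (intro sum.mono_neutral_right) (auto simp: B_def intro: weight_zero)
        also have "\<dots> = (\<Sum>W\<in>T. weight x W * (ratio q l * x $ l))"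
        proof -
          have "inj_on (insert l) T" by (auto simp: inj_on_def T_def S0_def insert_ident)
          then show ?thesis unfolding S1B by (simp add: sum.reindex attach(2))
        qed
        also have "\<dots> = (\<Sum>W\<in>{W \<in> S0. q \<in> W}. weight x W * (ratio q l * x $ l))"
          by (intro sum.mono_neutral_left) (auto simp: T_def B_def intro: weight_zero)
        also have "\<dots> = (\<Sum>W\<in>S0. if q \<in> W then weight x W * (ratio q l * x $ l) else 0)"
          by (rule sum.inter_filter) simp
        finally have "(\<Sum>W\<in>S1. weight x W) + (\<Sum>W\<in>S0. weight x W) =
            (\<Sum>W\<in>S0. (if q \<in> W then weight x W * (ratio q l * x $ l) else 0) + weight x W)"
          by (simp add: sum.distrib)
        also have "\<dots> = (\<Sum>W\<in>S0. weight x' W)"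
        proof (rule sum.cong)
          fix W assume "W \<in> S0"
          then have lW: "l \<notin> W" by (simp add: S0_def)
          have yx: "weight y W = weight x W" using lW by (intro weight_cong) (auto simp: y_def)
          show "(if q \<in> W then weight x W * (ratio q l * x $ l) else 0) + weight x W = weight x' W"
          proof (cases "q \<in> W")
            case True
            have "weight x' W = weight y W * (1 + ratio q l * x $ l)"
              unfolding x'_def using True by (rule weight_scale_coord)
            with True show ?thesis by (simp add: yx algebra_simps)
          next
            case False
            then have "weight x' W = weight y W" by (intro weight_cong) (auto simp: x'_def)
            with False yx show ?thesis by simp
          qed
        qed simp
        finally show ?thesis
          using split[of x] rhs IH lhs' by (simp add: weight_singleton)
      qed
    qed
  qed
  then show ?thesis by (simp add: exponent_weight)
qed

end

section \<open>Integration over coordinates\<close>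

lemma measurable_vec_nth [measurable]: "(\<lambda>x. x $ i) \<in> borel_measurable (borel :: (real ^ 'n) measure)"
  by (intro borel_measurable_continuous_onI continuous_intros)

lemma measurable_vecI:
  fixes f :: "'a \<Rightarrow> real ^ 'n"
  assumes "\<And>i. (\<lambda>x. f x $ i) \<in> borel_measurable M"
  shows "f \<in> borel_measurable M"
  unfolding borel_measurable_euclidean_space[of f]
  using assms by (auto simp: Basis_vec_def inner_axis)

lemma measurable_vec_lambda [measurable (raw)]:
  fixes f :: "'a \<Rightarrow> 'n::finite \<Rightarrow> real"
  assumes "\<And>i. (\<lambda>x. f x i) \<in> borel_measurable M"
  shows "(\<lambda>x. \<chi> i. f x i) \<in> borel_measurable M"
  by (rule measurable_vecI) (simp add: assms)

lemma measurable_vupd [measurable (raw)]: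
  fixes f :: "'a \<Rightarrow> real ^ 'n"
  assumes [measurable]: "f \<in> borel_measurable M" "g \<in> borel_measurable M"
  shows "(\<lambda>x. vupd (f x) i (g x)) \<in> borel_measurable M"
  unfolding vupd_def by measurable

interpretation lborel_family: product_sigma_finite "\<lambda>_. lborel :: real measure"
  by standard

text \<open>Lebesgue measure is characterized by its values on boxes. The identity makes Fubini for
  product measures available on vectors.\<close>

lemma distr_PiM_lborel_vec:
  "distr (PiM UNIV (\<lambda>_::'n::finite. lborel)) borel (\<lambda>f. \<chi> i. f i) = (lborel :: (real ^ 'n) measure)"
proof (rule lborel_eqI[symmetric])
  fix l u :: "real ^ 'n"
  assume le: "\<And>b. b \<in> Basis \<Longrightarrow> l \<bullet> b \<le> u \<bullet> b"
  have [measurable]: "(\<lambda>f. \<chi> i. f i) \<in> borel_measurable (PiM UNIV (\<lambda>_::'n. lborel :: real measure))"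
    by measurable
  have "(\<lambda>f. \<chi> i. f i) -` box l u \<inter> space (PiM UNIV (\<lambda>_::'n. lborel :: real measure)) =
      PiE UNIV (\<lambda>i. box (l $ i) (u $ i))"
    by (auto simp: space_PiM mem_box_cart PiE_def Pi_iff)
  then have "emeasure (distr (PiM UNIV (\<lambda>_::'n. lborel)) borel (\<lambda>f. \<chi> i. f i)) (box l u) =
      (\<Prod>i\<in>UNIV. emeasure lborel (box (l $ i) (u $ i)))"
    by (subst emeasure_distr) (simp_all add: lborel_family.emeasure_PiM)
  also have "\<dots> = (\<Prod>i\<in>UNIV. ennreal (u $ i - l $ i))"
    using le[of "axis _ 1"] by (intro prod.cong) (auto simp: inner_axis axis_in_Basis_iff)
  also have "\<dots> = ennreal (\<Prod>i\<in>UNIV. (u - l) $ i)"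
    using le[of "axis _ 1"] by (subst prod_ennreal) (auto simp: inner_axis axis_in_Basis_iff)
  also have "(\<Prod>i\<in>UNIV. (u - l) $ i) = (\<Prod>b\<in>Basis. (u - l) \<bullet> b)"
  proof -
    have basis: "(Basis :: (real ^ 'n) set) = (\<lambda>i. axis i 1) ` UNIV" by (auto simp: Basis_vec_def)
    have inj: "inj (\<lambda>i::'n. axis i (1::real))" by (simp add: inj_on_def axis_eq_axis)
    show ?thesis unfolding basis prod.reindex[OF inj] by (simp add: inner_axis)
  qed
  finally show "emeasure (distr (PiM UNIV (\<lambda>_::'n. lborel)) borel (\<lambda>f. \<chi> i. f i)) (box l u) =
      ennreal (\<Prod>b\<in>Basis. (u - l) \<bullet> b)" .
qed simp

lemma nn_integral_lborel_vec:
  assumes [measurable]: "g \<in> borel_measurable (borel :: (real ^ 'n) measure)"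
  shows "(\<integral>\<^sup>+ x. g x \<partial>lborel) = (\<integral>\<^sup>+ f. g (\<chi> i. f i) \<partial>PiM UNIV (\<lambda>_::'n. lborel))"
  by (subst distr_PiM_lborel_vec[symmetric]) (simp add: nn_integral_distr)

lemma nn_integral_lborel_vec_prod:
  fixes g :: "'n::finite \<Rightarrow> real \<Rightarrow> ennreal"
  assumes [measurable]: "\<And>i. g i \<in> borel_measurable borel"
  shows "(\<integral>\<^sup>+ x. (\<Prod>i\<in>UNIV. g i (x $ i)) \<partial>lborel) = (\<Prod>i\<in>UNIV. \<integral>\<^sup>+ t. g i t \<partial>lborel)"
  by (subst nn_integral_lborel_vec) (simp_all add: lborel_family.product_nn_integral_prod)

text \<open>By \<open>indep\<close> the factor \<open>k\<close> is constant along the direction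
  \<open>i\<close>, so after Fubini this is a linear substitution in one variable.\<close>

lemma nn_integral_scale_coord:
  fixes g :: "real ^ 'n \<Rightarrow> ennreal" and k :: "real ^ 'n \<Rightarrow> real"
  assumes g [measurable]: "g \<in> borel_measurable borel" and k [measurable]: "k \<in> borel_measurable borel"
    and pos: "\<And>x. k x > 0" and indep: "\<And>x t. k (vupd x i t) = k x"
  shows "(\<integral>\<^sup>+ x. g x \<partial>lborel) = (\<integral>\<^sup>+ x. ennreal (k x) * g (vupd x i (k x * x $ i)) \<partial>lborel)"
proof -
  let ?P = "\<lambda>I. PiM I (\<lambda>_::'n. lborel :: real measure)"
  have U: "UNIV = insert i (- {i})" by auto
  have upd: "(\<chi> j. (f(i := t)) j) = vupd (\<chi> j. f j) i t" for f :: "'n \<Rightarrow> real" and t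
    by (simp add: vec_eq_iff)
  have fubini: "(\<integral>\<^sup>+ x. h x \<partial>lborel) = (\<integral>\<^sup>+ f. \<integral>\<^sup>+ t. h (vupd (\<chi> j. f j) i t) \<partial>lborel \<partial>?P (- {i}))"
    if [measurable]: "h \<in> borel_measurable borel" for h :: "real ^ 'n \<Rightarrow> ennreal"
  proof -
    have "(\<integral>\<^sup>+ x. h x \<partial>lborel) = (\<integral>\<^sup>+ f. h (\<chi> j. f j) \<partial>?P (insert i (- {i})))"
      by (simp add: nn_integral_lborel_vec flip: U)
    also have "\<dots> = (\<integral>\<^sup>+ f. \<integral>\<^sup>+ t. h (\<chi> j. (f(i := t)) j) \<partial>lborel \<partial>?P (- {i}))"
      by (rule lborel_family.product_nn_integral_insert) (simp_all flip: U)
    finally show ?thesis by (simp only: upd)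
  qed
  have "(\<integral>\<^sup>+ t. g (vupd x i t) \<partial>lborel) =
      (\<integral>\<^sup>+ t. ennreal (k (vupd x i t)) * g (vupd (vupd x i t) i (k (vupd x i t) * vupd x i t $ i)) \<partial>lborel)" for x
  proof -
    have "(\<integral>\<^sup>+ t. g (vupd x i t) \<partial>lborel) = ennreal \<bar>k x\<bar> * (\<integral>\<^sup>+ t. g (vupd x i (0 + k x * t)) \<partial>lborel)"
      using pos[of x] by (intro nn_integral_real_affine) auto
    also have "\<dots> = (\<integral>\<^sup>+ t. ennreal (k x) * g (vupd x i (k x * t)) \<partial>lborel)"
      using pos[of x] by (subst nn_integral_cmult) simp_all
    finally show ?thesis by (simp add: indep)
  qed
  then show ?thesis by (simp add: fubini)
qed

section \<open>Factorization of the density of independent coordinates\<close>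

text \<open>A closed ball of the supremum norm: unlike a Euclidean ball it is a product of
  intervals, so independence factorizes its probability.\<close>

definition cube :: "real ^ 'n \<Rightarrow> real \<Rightarrow> (real ^ 'n) set" where
  "cube s e = {x. \<forall>i. \<bar>x $ i - s $ i\<bar> \<le> e}"

lemma cube_cbox: "cube s e = cbox (\<chi> i. s $ i - e) (\<chi> i. s $ i + e)"
  by (auto simp: cube_def mem_box_cart abs_le_iff algebra_simps)

lemma sets_cube [measurable]: "cube s e \<in> sets borel"
  by (simp add: cube_cbox)

lemma emeasure_cube:
  fixes s :: "real ^ 'n"
  assumes "e \<ge> 0"
  shows "emeasure lborel (cube s e) = ennreal ((2 * e) ^ CARD('n))"
proof -
  have "cube s e = {x. \<forall>i\<in>UNIV. x $ i \<in> {s $ i - e..s $ i + e}}"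
    by (auto simp: cube_def abs_le_iff algebra_simps)
  then have "indicator (cube s e) x = (\<Prod>i\<in>UNIV. indicator {s $ i - e..s $ i + e} (x $ i) :: ennreal)" for x
    by (simp add: indicator_def)
  then have "emeasure lborel (cube s e) =
      (\<integral>\<^sup>+ x. (\<Prod>i\<in>UNIV. indicator {s $ i - e..s $ i + e} (x $ i)) \<partial>lborel)"
    by (simp flip: nn_integral_indicator)
  also have "\<dots> = (\<Prod>i\<in>UNIV. \<integral>\<^sup>+ t. indicator {s $ i - e..s $ i + e} t \<partial>lborel)"
    by (rule nn_integral_lborel_vec_prod) measurable
  also have "\<dots> = (\<Prod>i\<in>(UNIV :: 'n set). ennreal (2 * e))"
    using assms by simp
  also have "\<dots> = ennreal ((2 * e) ^ CARD('n))"
    using assms by (simp add: ennreal_power)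
  finally show ?thesis .
qed

lemma cube_subset:
  fixes s :: "real ^ 'n"
  assumes "open U" "s \<in> U"
  shows "\<exists>d>0. \<forall>e\<le>d. cube s e \<subseteq> U"
proof -
  obtain d where d: "d > 0" "ball s d \<subseteq> U" using assms openE by blast
  have "cube s e \<subseteq> U" if e: "e \<le> d / (2 * real CARD('n))" for e
  proof
    fix x assume x: "x \<in> cube s e"
    have "norm (x - s) \<le> (\<Sum>i\<in>UNIV. \<bar>(x - s) $ i\<bar>)" by (rule norm_le_l1_cart)
    also have "\<dots> \<le> (\<Sum>i\<in>(UNIV :: 'n set). d / (2 * real CARD('n)))"
      using x e by (intro sum_mono) (auto simp: cube_def intro: order_trans)
    also have "\<dots> < d" using d by simp
    finally show "x \<in> U" using d by (auto simp: dist_norm norm_minus_commute)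
  qed
  moreover have "d / (2 * real CARD('n)) > 0" using d by simp
  ultimately show ?thesis by blast
qed

text \<open>Lebesgue differentiation at a point of continuity: near \<open>s\<close> the density is
  within h / 2 of q s, hence so is its mean over a small cube.\<close>

lemma cube_average_tendsto:
  fixes q :: "real ^ 'n \<Rightarrow> real"
  assumes q0: "\<And>x. q x \<ge> 0" and [measurable]: "q \<in> borel_measurable borel"
    and cont: "isCont q s" and p: "\<And>e. e > 0 \<Longrightarrow> ennreal (p e) = (\<integral>\<^sup>+ x. ennreal (q x) * indicator (cube s e) x \<partial>lborel)"
    and p0: "\<And>e. e > 0 \<Longrightarrow> p e \<ge> 0"
  shows "((\<lambda>e. p e / (2 * e) ^ CARD('n)) \<longlongrightarrow> q s) (at_right 0)"
proof (rule tendstoI)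
  fix h :: real assume "h > 0"
  define h2 where "h2 = h / 2"
  have h2: "h2 > 0" using \<open>h > 0\<close> by (simp add: h2_def)
  obtain U where U: "open U" "s \<in> U" "\<And>x. x \<in> U \<Longrightarrow> \<bar>q x - q s\<bar> < h2"
    using cont h2 unfolding continuous_at_open by (auto simp: dist_real_def abs_minus_commute dest!: spec[of _ "ball (q s) h2"])
  obtain d where d: "d > 0" "\<And>e. e \<le> d \<Longrightarrow> cube s e \<subseteq> U" using cube_subset[OF U(1,2)] by blast
  have "dist (p e / (2 * e) ^ CARD('n)) (q s) < h" if e: "0 < e" "e < d" for e
  proof -
    define V where "V = (2 * e) ^ CARD('n)"
    have V: "V > 0" using e by (simp add: V_def)
    have near: "\<bar>q x - q s\<bar> < h2" if "x \<in> cube s e" for x using U(3) d(2)[of e] e that by auto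
    have "emeasure lborel (cube s e) = ennreal V"
      unfolding V_def using e(1) by (intro emeasure_cube) simp
    then have const: "(\<integral>\<^sup>+ x. ennreal c * indicator (cube s e) x \<partial>lborel) = ennreal (c * V)" for c
      using V by (simp add: nn_integral_cmult_indicator ennreal_mult'')
    have "ennreal (p e) \<le> (\<integral>\<^sup>+ x. ennreal (q s + h2) * indicator (cube s e) x \<partial>lborel)"
      unfolding p[OF e(1)] using near
      by (intro nn_integral_mono) (force simp: indicator_def intro!: ennreal_leI)
    then have up: "p e \<le> (q s + h2) * V"
      unfolding const using q0[of s] h2 V by (subst (asm) ennreal_le_iff) auto
    have "(\<integral>\<^sup>+ x. ennreal (q s - h2) * indicator (cube s e) x \<partial>lborel) \<le> ennreal (p e)"
      unfolding p[OF e(1)] using near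
      by (intro nn_integral_mono) (force simp: indicator_def intro!: ennreal_leI)
    then have lo: "(q s - h2) * V \<le> p e"
      unfolding const using p0[OF e(1)] by (subst (asm) ennreal_le_iff) auto
    have "q s - h2 \<le> p e / V" "p e / V \<le> q s + h2"
      using up lo V by (simp_all add: field_simps)
    then show ?thesis using h2 h2_def unfolding dist_real_def V_def[symmetric] by linarith
  qed
  then show "\<forall>\<^sub>F e in at_right 0. dist (p e / (2 * e) ^ CARD('n)) (q s) < h"
    using d(1) by (auto simp: eventually_at_right_field)
qed

text \<open>The identity is exact for cube probabilities, which are products of one-coordinate
  terms: exchanging the two \<open>i\<close>-th factors leaves the overall product unchanged.
  Division by the volumes and shrinking the cubes carry it over to \<open>q\<close>.\<close>

lemma (in prob_space) independent_density_exchange: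
  fixes q :: "real ^ 'n \<Rightarrow> real" and S :: "'a \<Rightarrow> real ^ 'n"
  assumes S: "distributed M lborel S (\<lambda>x. ennreal (q x))"
    and q0: "\<And>x. q x \<ge> 0" and cont: "continuous_on U q" and U: "open U"
    and indep: "indep_vars (\<lambda>_. borel) (\<lambda>i \<omega>. S \<omega> $ i) UNIV"
    and mem: "s \<in> U" "s' \<in> U" "vupd s i (s' $ i) \<in> U" "vupd s' i (s $ i) \<in> U"
  shows "q s * q s' = q (vupd s i (s' $ i)) * q (vupd s' i (s $ i))"
proof -
  have [measurable]: "q \<in> borel_measurable borel"
    using distributed_real_measurable[OF _ S] q0 by simp
  have Sm [measurable]: "S \<in> borel_measurable M"
    using distributed_measurable[OF S] by simp
  define p where "p s e = prob (S -` cube s e \<inter> space M)" for s e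
  define m where "m j t e = prob ((\<lambda>\<omega>. S \<omega> $ j) -` {t - e..t + e} \<inter> space M)" for j t e
  have p_emeasure: "ennreal (p s e) = (\<integral>\<^sup>+ x. ennreal (q x) * indicator (cube s e) x \<partial>lborel)" for s e
    unfolding p_def using distributed_emeasure[OF S, of "cube s e"] by (simp add: emeasure_eq_measure)
  have p_prod: "p s e = (\<Prod>j\<in>UNIV. m j (s $ j) e)" for s e
  proof -
    have "S -` cube s e \<inter> space M = (\<Inter>j\<in>UNIV. (\<lambda>\<omega>. S \<omega> $ j) -` {s $ j - e..s $ j + e} \<inter> space M)"
      by (auto simp: cube_def abs_le_iff algebra_simps)
    then show ?thesis unfolding p_def m_def using indep_varsD_finite[OF indep] by simp
  qed
  have lim: "((\<lambda>e. p s e / (2 * e) ^ CARD('n)) \<longlongrightarrow> q s) (at_right 0)" if "s \<in> U" for s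
  proof (rule cube_average_tendsto[OF q0])
    show "isCont q s" using cont U that by (simp add: continuous_on_eq_continuous_at)
  qed (simp_all add: p_emeasure, simp add: p_def)
  have exch: "p s e * p s' e = p (vupd s i (s' $ i)) e * p (vupd s' i (s $ i)) e" for e
    by (simp add: p_prod prod.remove[of UNIV i])
  have "((\<lambda>e. p s e / (2 * e) ^ CARD('n) * (p s' e / (2 * e) ^ CARD('n))) \<longlongrightarrow> q s * q s') (at_right 0)"
    using mem by (intro tendsto_mult lim)
  moreover have "((\<lambda>e. p (vupd s i (s' $ i)) e / (2 * e) ^ CARD('n) * (p (vupd s' i (s $ i)) e / (2 * e) ^ CARD('n)))
      \<longlongrightarrow> q (vupd s i (s' $ i)) * q (vupd s' i (s $ i))) (at_right 0)"
    using mem by (intro tendsto_mult lim)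
  ultimately show ?thesis
    using tendsto_unique[of "at_right (0::real)"] by (simp add: exch)
qed

section \<open>Change of variables\<close>

context weighted_tree
begin

definition jac :: "'v \<Rightarrow> real ^ 'v \<Rightarrow> real" where
  "jac r s = (\<Prod>i\<in>UNIV. 1 / den r s i)"

lemma jac_pos: "jac r s > 0"
  unfolding jac_def by (intro prod_pos) (simp add: den_pos)

lemma measurable_den [measurable]: "(\<lambda>s. den r s i) \<in> borel_measurable borel"
  unfolding den_def by measurable

lemma measurable_jac [measurable]: "jac r \<in> borel_measurable borel"
  unfolding jac_def by measurable

lemma measurable_Psi [measurable]: "Psi r \<in> borel_measurable borel"
  unfolding Psi_def by measurable

text \<open>The coordinates are rescaled one at a time, ancestors first, so that the scale factor of a
  coordinate depends only on coordinates that have not been touched yet.\<close>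

lemma nn_integral_Psi:
  fixes g :: "real ^ 'v \<Rightarrow> ennreal"
  assumes [measurable]: "g \<in> borel_measurable borel"
  shows "(\<integral>\<^sup>+ x. g x \<partial>lborel) = (\<integral>\<^sup>+ s. ennreal (jac r s) * g (Psi r s) \<partial>lborel)"
proof -
  define part where "part B s = (\<chi> i. if i \<in> B then s $ i / den r s i else s $ i)" for B and s :: "real ^ 'v"
  define pjac where "pjac B s = (\<Prod>i\<in>B. 1 / den r s i)" for B and s :: "real ^ 'v"
  have [measurable]: "part B \<in> borel_measurable borel" for B
    unfolding part_def by measurable
  have [measurable]: "pjac B \<in> borel_measurable borel" for B
    unfolding pjac_def by measurable
  have "(\<integral>\<^sup>+ x. g x \<partial>lborel) = (\<integral>\<^sup>+ s. ennreal (pjac B s) * g (part B s) \<partial>lborel)"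
    if "g \<in> borel_measurable borel" for B and g :: "real ^ 'v \<Rightarrow> ennreal"
    using finite[of B] that
  proof (induction B arbitrary: g rule: finite_ranking_induct[where f = "dist_from r"])
    case empty
    have "part {} s = s" for s by (simp add: part_def vec_eq_iff)
    then show ?case by (simp add: pjac_def)
  next
    case (insert l B)
    show ?case
    proof (cases "l \<in> B")
      case True
      then show ?thesis using insert.IH[OF insert.prems] by (simp only: insert_absorb)
    next
      case False
      note [measurable] = insert.prems
      define k where "k s = 1 / den r s l" for s
      have [measurable]: "k \<in> borel_measurable borel" unfolding k_def by measurable
      have ch: "j \<notin> B" "j \<noteq> l" if "j \<in> children E r l" for j
        using that insert.hyps(2)[of j] by (auto simp: in_children_iff)
      have den_part: "den r (part B s) l = den r s l" for s
        unfolding den_def using ch by (intro prod.cong) (auto simp: part_def)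
      have upd: "vupd (part B s) l (k s * part B s $ l) = part (insert l B) s" for s
        using False by (auto simp: vec_eq_iff part_def k_def)
      have "(\<integral>\<^sup>+ x. g x \<partial>lborel) = (\<integral>\<^sup>+ x. ennreal (k x) * g (vupd x l (k x * x $ l)) \<partial>lborel)"
      proof (rule nn_integral_scale_coord)
        fix x t
        show "k x > 0" by (simp add: k_def den_pos)
        have "den r (vupd x l t) l = den r x l"
          unfolding den_def using ch(2) by (intro prod.cong) auto
        then show "k (vupd x l t) = k x" by (simp add: k_def)
      qed measurable
      also have "\<dots> = (\<integral>\<^sup>+ s. ennreal (pjac B s) *
          (ennreal (k (part B s)) * g (vupd (part B s) l (k (part B s) * part B s $ l))) \<partial>lborel)"
        by (rule insert.IH) measurable
      also have "\<dots> = (\<integral>\<^sup>+ s. ennreal (pjac (insert l B) s) * g (part (insert l B) s) \<partial>lborel)"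
      proof (rule nn_integral_cong)
        fix s
        have k: "k (part B s) = k s" by (simp add: k_def den_part)
        have "pjac B s \<ge> 0" unfolding pjac_def by (intro prod_nonneg) (simp add: den_pos less_imp_le)
        moreover have "pjac (insert l B) s = pjac B s * k s"
          using False by (simp add: pjac_def k_def)
        ultimately show "ennreal (pjac B s) * (ennreal (k (part B s)) *
            g (vupd (part B s) l (k (part B s) * part B s $ l))) =
            ennreal (pjac (insert l B) s) * g (part (insert l B) s)"
          by (simp only: k upd) (simp add: ennreal_mult' mult.assoc)
      qed
      finally show ?thesis .
    qed
  qed
  from this[OF assms, of UNIV] show ?thesis
    unfolding pjac_def part_def jac_def Psi_def by simp
qed

lemma distributed_Phi:
  assumes X: "distributed M lborel X (\<lambda>x. ennreal (f x))"
    and f0: "\<And>x. f x \<ge> 0" and f_zero: "\<And>x. x \<notin> pos_orthant \<Longrightarrow> f x = 0"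
  shows "distributed M lborel (\<lambda>\<omega>. Phi E C r (X \<omega>)) (\<lambda>s. ennreal (f (Psi r s) * jac r s))"
proof -
  have f [measurable]: "f \<in> borel_measurable borel"
    using distributed_real_measurable[OF _ X] f0 by simp
  have Xm [measurable]: "X \<in> borel_measurable M"
    using distributed_measurable[OF X] by simp
  have "distr M lborel (\<lambda>\<omega>. Phi E C r (X \<omega>)) = density lborel (\<lambda>s. ennreal (f (Psi r s) * jac r s))"
  proof (rule measure_eqI)
    fix A assume "A \<in> sets (distr M lborel (\<lambda>\<omega>. Phi E C r (X \<omega>)))"
    then have A [measurable]: "A \<in> sets borel" by simp
    have B: "Phi E C r -` A \<in> sets borel" using measurable_sets[OF measurable_Phi A, of r] by simp
    note [measurable] = B
    have "emeasure (distr M lborel (\<lambda>\<omega>. Phi E C r (X \<omega>))) A = emeasure M (X -` (Phi E C r -` A) \<inter> space M)"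
      by (subst emeasure_distr) (auto intro!: arg_cong[where f = "emeasure M"])
    also have "\<dots> = (\<integral>\<^sup>+ x. ennreal (f x) * indicator (Phi E C r -` A) x \<partial>lborel)"
      using B by (intro distributed_emeasure[OF X]) simp
    also have "\<dots> = (\<integral>\<^sup>+ s. ennreal (jac r s) * (ennreal (f (Psi r s)) * indicator (Phi E C r -` A) (Psi r s)) \<partial>lborel)"
      by (rule nn_integral_Psi) measurable
    also have "\<dots> = (\<integral>\<^sup>+ s. ennreal (f (Psi r s) * jac r s) * indicator A s \<partial>lborel)"
    proof (rule nn_integral_cong)
      fix s
      show "ennreal (jac r s) * (ennreal (f (Psi r s)) * indicator (Phi E C r -` A) (Psi r s)) =
          ennreal (f (Psi r s) * jac r s) * indicator A s"
      \<comment> \<open>Inside the orthant \<open>Phi\<close> undoes \<open>Psi\<close>; a point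
        outside is kept outside by \<open>Psi\<close>, and \<open>f\<close> vanishes there.\<close>
      proof (cases "s \<in> pos_orthant")
        case True
        then show ?thesis
          using f0 jac_pos[of r s]
          by (simp add: Phi_Psi indicator_def ennreal_mult' ac_simps)
      next
        case False
        then show ?thesis using Psi_pos_iff[of r s] f_zero[of "Psi r s"] by simp
      qed
    qed
    also have "\<dots> = emeasure (density lborel (\<lambda>s. ennreal (f (Psi r s) * jac r s))) A"
      by (intro emeasure_density[symmetric]) measurable
    finally show "emeasure (distr M lborel (\<lambda>\<omega>. Phi E C r (X \<omega>))) A =
        emeasure (density lborel (\<lambda>s. ennreal (f (Psi r s) * jac r s))) A" .
  qed simp
  then show ?thesis by (simp add: distributed_def)
qed

end

section \<open>Independence for all leaf roots\<close>

lemma open_pos_orthant: "open (pos_orthant :: (real ^ 'n) set)"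
proof -
  have "open (\<Inter>i. {x :: real ^ 'n. 0 < x $ i})"
    by (intro open_INT ballI open_Collect_less continuous_intros) simp
  moreover have "(\<Inter>i. {x :: real ^ 'n. 0 < x $ i}) = pos_orthant" by (auto simp: pos_orthant_def)
  ultimately show ?thesis by simp
qed

lemma prod_exchange:
  fixes w :: "'n::finite \<Rightarrow> real \<Rightarrow> real"
  shows "(\<Prod>j\<in>A. w j (s $ j)) * (\<Prod>j\<in>A. w j (s' $ j)) =
    (\<Prod>j\<in>A. w j (vupd s i (s' $ i) $ j)) * (\<Prod>j\<in>A. w j (vupd s' i (s $ i) $ j))"
  unfolding prod.distrib[symmetric] by (intro prod.cong) auto

context weighted_tree
begin

text \<open>Regrouping by children makes the Jacobian a product of functions of one coordinate each.
  It therefore satisfies the exchange identity by itself and cancels from that of the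
  density.\<close>

lemma jac_edges: "jac r s = (\<Prod>j\<in>-{r}. 1 / (1 + ratio (parent E r j) j * \<bar>s $ j\<bar>))"
proof -
  have "jac r s = (\<Prod>i\<in>UNIV. \<Prod>j\<in>children E r i. 1 / (1 + ratio i j * \<bar>s $ j\<bar>))"
    by (simp add: jac_def den_def prod_dividef)
  then show ?thesis by (simp only: prod_children)
qed

lemma jac_exchange:
  "jac r s * jac r s' = jac r (vupd s i (s' $ i)) * jac r (vupd s' i (s $ i))"
  unfolding jac_edges by (rule prod_exchange[where w = "\<lambda>j t. 1 / (1 + ratio (parent E r j) j * \<bar>t\<bar>)"])

lemma continuous_den: "continuous_on UNIV (\<lambda>s. den r s i)"
  unfolding den_def by (intro continuous_intros)

lemma continuous_Psi: "continuous_on UNIV (Psi r)"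
  unfolding Psi_def
  by (intro continuous_on_vec_lambda continuous_intros continuous_den) (simp add: den_pos less_imp_neq[symmetric])

lemma continuous_jac: "continuous_on UNIV (jac r)"
  unfolding jac_def
  by (intro continuous_intros continuous_den) (simp add: den_pos less_imp_neq[symmetric])

lemma den_vupd:
  assumes s: "s \<in> pos_orthant" and t: "t > 0"
  shows "den r (vupd s i t) k =
    (if i \<noteq> r \<and> k = parent E r i
     then den r s k * ((1 + ratio k i * t) / (1 + ratio k i * s $ i)) else den r s k)"
proof (cases "i \<noteq> r \<and> k = parent E r i")
  case True
  then have i: "i \<in> children E r k" using parent_child by blast
  have si: "s $ i > 0" using s by (simp add: pos_orthant_def)
  have "1 + ratio k i * s $ i > 0" using si ratio_child[OF i] by (simp add: add_pos_pos)
  then show ?thesis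
    using True i si t unfolding den_def by (simp add: prod.remove[of _ i] field_simps)
next
  case False
  then have "i \<notin> children E r k" using children_iff_parent by blast
  then show ?thesis using False unfolding den_def by (auto intro!: prod.cong)
qed

text \<open>The coordinate s_i enters x_i proportionally and otherwise only the denominator of its
  parent. Writing the result as a displacement of \<open>x\<close> lets the curve be differentiated
  term by term.\<close>

lemma Psi_vupd:
  assumes s: "s \<in> pos_orthant" and t: "t > 0" and x: "x = Psi r s" and p: "p = parent E r i"
  shows "Psi r (vupd s i t) = x + (t / s $ i - 1) *\<^sub>R axis i (x $ i) +
    (if i = r then 0 else ((1 + ratio p i * s $ i) / (1 + ratio p i * t) - 1) *\<^sub>R axis p (x $ p))"
proof -
  have si: "s $ i > 0" using s by (simp add: pos_orthant_def)
  have "Psi r (vupd s i t) $ k = (x + (t / s $ i - 1) *\<^sub>R axis i (x $ i) +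
    (if i = r then 0 else ((1 + ratio p i * s $ i) / (1 + ratio p i * t) - 1) *\<^sub>R axis p (x $ p))) $ k" for k
  proof (cases "i = r")
    case True
    then show ?thesis using si by (auto simp: den_vupd[OF s t] x axis_def field_simps)
  next
    case False
    have pi: "p \<noteq> i" using parent_ne[OF False] p by simp
    have rho: "ratio p i > 0" using ratio_pos parent_edge[OF False] p by simp
    have pos: "1 + ratio p i * s $ i > 0" "1 + ratio p i * t > 0" "den r s k > 0" for k
      using rho si t den_pos by (simp_all add: add_pos_pos)
    consider "k = i" | "k = p" | "k \<noteq> i" "k \<noteq> p" by blast
    then show ?thesis
    proof cases
      case 1
      then show ?thesis
        using False pi si pos(3)[of i] by (simp add: den_vupd[OF s t] x axis_def p[symmetric] field_simps)
    next
      case 2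
      then show ?thesis
        using False pi si pos by (simp add: den_vupd[OF s t] x axis_def p[symmetric] divide_simps) (simp add: algebra_simps)
    next
      case 3
      then show ?thesis
        using False by (simp add: den_vupd[OF s t] x axis_def p[symmetric])
    qed
  qed
  then show ?thesis by (simp add: vec_eq_iff)
qed

end

section \<open>Logarithmic derivatives of the density under independence at the leaves\<close>

locale leaf_independence = weighted_tree E C + prob_space M
  for E :: "'v::finite set set" and C :: "real ^ 'v ^ 'v" and M :: "'w measure" +
  fixes X :: "'w \<Rightarrow> real ^ 'v" and f :: "real ^ 'v \<Rightarrow> real" and grad_f :: "real ^ 'v \<Rightarrow> real ^ 'v"
  assumes size: "CARD('v) \<ge> 2"
    and X_density: "distributed M lborel X (\<lambda>x. ennreal (f x))"
    and f_pos: "\<And>x. x \<in> pos_orthant \<Longrightarrow> f x > 0"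
    and f_zero: "\<And>x. x \<notin> pos_orthant \<Longrightarrow> f x = 0"
    and f_deriv: "\<And>x. x \<in> pos_orthant \<Longrightarrow> GDERIV f x :> grad_f x"
    and f_C1: "continuous_on pos_orthant grad_f"
    and indep: "\<And>r. is_leaf E r \<Longrightarrow>
      indep_vars (\<lambda>_. borel) (\<lambda>i \<omega>. Phi E C r (X \<omega>) $ i) UNIV"
begin

lemma f_nonneg: "f x \<ge> 0"
  using f_pos[of x] f_zero[of x] by (cases "x \<in> pos_orthant") auto

lemma f_isCont: "x \<in> pos_orthant \<Longrightarrow> isCont f x"
  using f_deriv has_derivative_continuous unfolding gderiv_def by blast

lemma continuous_f: "continuous_on pos_orthant f"
  using f_isCont by (simp add: continuous_at_imp_continuous_on)

lemma continuous_f_Psi: "continuous_on pos_orthant (\<lambda>s. f (Psi r s))"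
  by (rule continuous_on_compose2[OF continuous_f continuous_on_subset[OF continuous_Psi]])
    (auto simp: Psi_pos_iff)

lemma f_Psi_exchange:
  assumes r: "is_leaf E r" and s: "s \<in> pos_orthant" "s' \<in> pos_orthant"
  shows "f (Psi r s) * f (Psi r s') = f (Psi r (vupd s i (s' $ i))) * f (Psi r (vupd s' i (s $ i)))"
proof -
  let ?q = "\<lambda>s. f (Psi r s) * jac r s"
  have up: "vupd s i (s' $ i) \<in> pos_orthant" "vupd s' i (s $ i) \<in> pos_orthant"
    using s by (auto intro!: vupd_pos simp: pos_orthant_def)
  have "?q s * ?q s' = ?q (vupd s i (s' $ i)) * ?q (vupd s' i (s $ i))"
  proof (rule independent_density_exchange[where U = pos_orthant and q = ?q])
    show "distributed M lborel (\<lambda>\<omega>. Phi E C r (X \<omega>)) (\<lambda>s. ennreal (f (Psi r s) * jac r s))"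
      by (rule distributed_Phi[OF X_density f_nonneg f_zero])
    show "continuous_on pos_orthant ?q"
      by (intro continuous_intros continuous_f_Psi continuous_on_subset[OF continuous_jac]) auto
    show "0 \<le> f (Psi r x) * jac r x" for x
      using f_nonneg less_imp_le[OF jac_pos] by (intro mult_nonneg_nonneg)
  qed (use indep[OF r] s up open_pos_orthant in auto)
  then have "f (Psi r s) * f (Psi r s') * (jac r s * jac r s') =
      f (Psi r (vupd s i (s' $ i))) * f (Psi r (vupd s' i (s $ i))) *
        (jac r (vupd s i (s' $ i)) * jac r (vupd s' i (s $ i)))"
    by (simp add: ac_simps)
  then show ?thesis using jac_pos unfolding jac_exchange[of r s s' i, symmetric]
    by (simp add: less_imp_neq[symmetric])
qed

definition D :: "'v \<Rightarrow> real ^ 'v \<Rightarrow> real" where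
  "D i x = x $ i * grad_f x $ i / f x"

definition logistic :: "real \<Rightarrow> real" where
  "logistic y = y / (1 + y)"

definition L :: "'v \<Rightarrow> 'v \<Rightarrow> real ^ 'v \<Rightarrow> real" where
  "L r i x = D i x - (if i = r then 0
     else logistic (ratio (parent E r i) i * comp r x i) * D (parent E r i) x)"

text \<open>In the coordinates \<open>s = Phi r x\<close>, the quantity \<open>L r i x\<close> is the logarithmic derivative
  \<open>s_i * d log f / d s_i\<close>.\<close>

lemma f_Psi_deriv:
  assumes s: "s \<in> pos_orthant"
  shows "((\<lambda>t. f (Psi r (vupd s i t))) has_real_derivative
    f (Psi r s) / s $ i * L r i (Psi r s)) (at (s $ i))"
proof -
  define x where "x = Psi r s"
  define p where "p = parent E r i"
  define \<rho> where "\<rho> = ratio p i"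
  have si: "s $ i > 0" using s by (simp add: pos_orthant_def)
  have xP: "x \<in> pos_orthant" using s by (simp add: x_def Psi_pos)
  have fx: "f x > 0" using f_pos[OF xP] .
  have rho: "\<rho> > 0" if "i \<noteq> r" using ratio_pos parent_edge[OF that] by (simp add: \<rho>_def p_def)
  \<comment> \<open>The explicit curve from \<open>Psi_vupd\<close>. Its velocity \<open>v\<close>
    has components at \<open>i\<close> and, away from the root, at the parent \<open>p\<close>
    only.\<close>
  define \<gamma> where "\<gamma> t = x + (t / s $ i - 1) *\<^sub>R axis i (x $ i) +
    (if i = r then 0 else ((1 + \<rho> * s $ i) / (1 + \<rho> * t) - 1) *\<^sub>R axis p (x $ p))" for t
  define v where "v = (1 / s $ i) *\<^sub>R axis i (x $ i) +
    (if i = r then 0 else (- \<rho> / (1 + \<rho> * s $ i)) *\<^sub>R axis p (x $ p))"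
  have \<gamma>': "(\<gamma> has_vector_derivative v) (at (s $ i))"
  proof (cases "i = r")
    case True
    have "((\<lambda>t. t / s $ i - 1) has_real_derivative 1 / s $ i) (at (s $ i))"
      using DERIV_diff[OF DERIV_cdivide[OF DERIV_ident] DERIV_const] by fastforce
    then have "((\<lambda>t. x + (t / s $ i - 1) *\<^sub>R axis i (x $ i)) has_vector_derivative
        (1 / s $ i) *\<^sub>R axis i (x $ i)) (at (s $ i))"
      using has_vector_derivative_add[OF has_vector_derivative_const
          has_vector_derivative_scaleR[OF _ has_vector_derivative_const]]
      by fastforce
    then show ?thesis using True by (simp add: \<gamma>_def[abs_def] v_def)
  next
    case False
    have pos: "1 + \<rho> * s $ i > 0" using rho[OF False] si by (simp add: add_pos_pos)
    have d1: "((\<lambda>t. t / s $ i - 1) has_real_derivative 1 / s $ i) (at (s $ i))"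
      using DERIV_diff[OF DERIV_cdivide[OF DERIV_ident] DERIV_const] by fastforce
    have "((\<lambda>t. 1 + \<rho> * t) has_real_derivative \<rho>) (at (s $ i))"
      by (auto intro!: derivative_eq_intros)
    from DERIV_diff[OF DERIV_divide[OF DERIV_const[of "1 + \<rho> * s $ i"] this] DERIV_const[of 1]]
    have d2: "((\<lambda>t. (1 + \<rho> * s $ i) / (1 + \<rho> * t) - 1) has_real_derivative
        - \<rho> / (1 + \<rho> * s $ i)) (at (s $ i))"
      using pos by simp
    have "((\<lambda>t. x + (t / s $ i - 1) *\<^sub>R axis i (x $ i) +
          ((1 + \<rho> * s $ i) / (1 + \<rho> * t) - 1) *\<^sub>R axis p (x $ p)) has_vector_derivative
        (1 / s $ i) *\<^sub>R axis i (x $ i) + (- \<rho> / (1 + \<rho> * s $ i)) *\<^sub>R axis p (x $ p)) (at (s $ i))"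
      using has_vector_derivative_add[OF has_vector_derivative_add[OF has_vector_derivative_const
          has_vector_derivative_scaleR[OF d1 has_vector_derivative_const]]
          has_vector_derivative_scaleR[OF d2 has_vector_derivative_const]]
      by simp
    then show ?thesis using False by (simp add: \<gamma>_def[abs_def] v_def)
  qed
  have "\<gamma> (s $ i) = x"
  proof (cases "i = r")
    case False
    have "1 + \<rho> * s $ i > 0" using rho[OF False] si by (simp add: add_pos_pos)
    then show ?thesis using si by (simp add: \<gamma>_def)
  qed (use si in \<open>simp add: \<gamma>_def\<close>)
  then have "(f has_derivative (\<lambda>h. h \<bullet> grad_f x)) (at (\<gamma> (s $ i)))"
    using f_deriv[OF xP] by (simp add: gderiv_def)
  then have "((f \<circ> \<gamma>) has_derivative (\<lambda>h. h \<bullet> grad_f x) \<circ> (\<lambda>h. h *\<^sub>R v)) (at (s $ i))"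
    using \<gamma>' unfolding has_vector_derivative_def by (rule diff_chain_at[rotated])
  then have "((f \<circ> \<gamma>) has_real_derivative v \<bullet> grad_f x) (at (s $ i))"
    by (simp add: has_field_derivative_def o_def mult.commute[of _ "v \<bullet> grad_f x"] fun_eq_iff)

  moreover have "v \<bullet> grad_f x = f x / s $ i * L r i x"
  proof -
    have "comp r x i = s $ i" using s by (simp add: x_def comp_Psi)
    then have L: "L r i x = x $ i * grad_f x $ i / f x -
        (if i = r then 0 else \<rho> * s $ i / (1 + \<rho> * s $ i) * (x $ p * grad_f x $ p / f x))"
      by (simp add: L_def D_def logistic_def flip: \<rho>_def p_def)
    have v: "v \<bullet> grad_f x = x $ i * grad_f x $ i / s $ i -
        (if i = r then 0 else \<rho> / (1 + \<rho> * s $ i) * (x $ p * grad_f x $ p))"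
      by (simp add: v_def inner_add_left inner_axis')
    have "f x / s $ i * (x $ i * grad_f x $ i / f x) = x $ i * grad_f x $ i / s $ i"
      using fx by simp
    moreover have "f x / s $ i * (\<rho> * s $ i / (1 + \<rho> * s $ i) * (x $ p * grad_f x $ p / f x)) =
        \<rho> / (1 + \<rho> * s $ i) * (x $ p * grad_f x $ p)"
      using fx si by simp
    ultimately show ?thesis unfolding L v right_diff_distrib by (cases "i = r") (simp_all only: simp_thms if_True if_False mult_zero_right)
  qed
  ultimately have "((f \<circ> \<gamma>) has_real_derivative f x / s $ i * L r i x) (at (s $ i))" by simp
  then show ?thesis
    unfolding x_def
    by (rule has_field_derivative_transform_within_open[where S = "{0<..}"])
      (use si in \<open>auto simp: \<gamma>_def Psi_vupd[OF s _ x_def p_def] \<rho>_def\<close>)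
qed

text \<open>Both points have the same coordinate s_i. Exchanging it with a variable t > 0 gives f x
  * f (Psi r (vupd s' i t)) = f (Psi r (vupd s i t)) * f x', and the two sides have the same
  derivative at the common value.\<close>

lemma L_leaf:
  assumes r: "is_leaf E r" and x: "x \<in> pos_orthant" "x' \<in> pos_orthant"
    and eq: "comp r x i = comp r x' i"
  shows "L r i x = L r i x'"
proof -
  define s s' where "s = Phi E C r x" and "s' = Phi E C r x'"
  have s: "s \<in> pos_orthant" "s' \<in> pos_orthant" "Psi r s = x" "Psi r s' = x'" "s $ i = s' $ i"
    using x eq by (simp_all add: s_def s'_def Phi_pos Psi_Phi)
  have si: "s $ i > 0" using s by (simp add: pos_orthant_def)
  have "f x * f (Psi r (vupd s' i t)) = f (Psi r (vupd s i t)) * f x'" if "t > 0" for t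
    using f_Psi_exchange[OF r s(1) vupd_pos[OF s(2) that], of i i] s by simp
  moreover have "((\<lambda>t. f x * f (Psi r (vupd s' i t))) has_real_derivative
      f x * (f x' / s' $ i * L r i x')) (at (s' $ i))"
    using f_Psi_deriv[OF s(2), of r i] s(4) by (intro DERIV_cmult) simp
  ultimately have "((\<lambda>t. f (Psi r (vupd s i t)) * f x') has_real_derivative
      f x * (f x' / s' $ i * L r i x')) (at (s' $ i))"
    using si s(5) by (elim has_field_derivative_transform_within_open[where S = "{0<..}"]) auto
  moreover have "((\<lambda>t. f (Psi r (vupd s i t)) * f x') has_real_derivative
      f x / s $ i * L r i x * f x') (at (s $ i))"
    using f_Psi_deriv[OF s(1), of r i] s(3) by (intro DERIV_cmult_right) simp
  ultimately have "f x * (f x' / s' $ i * L r i x') = f x / s $ i * L r i x * f x'"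
    using DERIV_unique s(5) by metis
  then show ?thesis using si s(5) f_pos[OF x(1)] f_pos[OF x(2)] by simp
qed

text \<open>For a leaf \<open>r\<close> behind \<open>j\<close>, the parent of \<open>i\<close> is
  \<open>j\<close>, the message at \<open>i\<close> is the one sent to \<open>j\<close>, and
  \<open>L r i\<close> involves only \<open>D i\<close> and \<open>D j\<close>. The leaf thus
  disappears from the result.\<close>

lemma L_edge:
  assumes ij: "{i, j} \<in> E" and x: "x \<in> pos_orthant" "x' \<in> pos_orthant"
    and eq: "comp j x i = comp j x' i"
  shows "D i x - logistic (ratio j i * comp j x i) * D j x =
    D i x' - logistic (ratio j i * comp j x' i) * D j x'"
proof -
  obtain r where r: "is_leaf E r" "i \<noteq> r" "parent E r i = j"
    using leaf_behind_edge[OF ij] by blast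
  have "comp r y i = comp j y i" for y using comp_parent_nbr[OF r(2), of y] r(3) by simp
  then show ?thesis using L_leaf[OF r(1) x, of i] eq r by (simp add: L_def)
qed

section \<open>Elimination of the neighbours: \<open>D i\<close> as a function of the message at
  root \<open>i\<close>\<close>

lemma logistic_bounds: "y > 0 \<Longrightarrow> 0 < logistic y \<and> logistic y < 1"
  by (simp add: logistic_def)

text \<open>The two directions of the edge give two homogeneous linear equations for the increments
  of \<open>D i\<close> and \<open>D j\<close>, with determinant 1 - \<alpha> * \<beta> > 0.\<close>

lemma D_edge:
  assumes ij: "{i, j} \<in> E" and x: "x \<in> pos_orthant" "x' \<in> pos_orthant"
    and eq: "comp j x i = comp j x' i" "comp i x j = comp i x' j"
  shows "D i x = D i x'"
proof -
  have ji: "{j, i} \<in> E" using ij by (simp add: insert_commute)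
  define \<alpha> \<beta> where "\<alpha> = logistic (ratio j i * comp j x i)" and "\<beta> = logistic (ratio i j * comp i x j)"
  have "D i x - \<alpha> * D j x = D i x' - \<alpha> * D j x'" "D j x - \<beta> * D i x = D j x' - \<beta> * D i x'"
    using L_edge[OF ij x eq(1)] L_edge[OF ji x eq(2)] eq by (simp_all add: \<alpha>_def \<beta>_def)
  then have "(D i x - D i x') * (1 - \<alpha> * \<beta>) = 0" by algebra
  moreover have "\<alpha> * \<beta> < 1"
  proof -
    have "0 < \<alpha>" "\<alpha> < 1" "0 < \<beta>" "\<beta> < 1"
      using logistic_bounds ratio_pos[OF ij] ratio_pos[OF ji] comp_pos[OF x(1)]
      by (auto simp: \<alpha>_def \<beta>_def)
    then show ?thesis using mult_strict_mono[of \<alpha> 1 \<beta> 1] by simp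
  qed
  ultimately show ?thesis by simp
qed

lemma ex_nbr: "nbrs i \<noteq> {}"
proof -
  have "\<exists>v. i \<noteq> v"
  proof (rule ccontr)
    assume "\<nexists>v. i \<noteq> v"
    then have "UNIV = {i}" by auto
    then have "CARD('v) = card {i}" by (rule arg_cong)
    with size show False by simp
  qed
  then obtain v where "i \<noteq> v" by blast
  then show ?thesis using nbrs_parent[of i v] by blast
qed

text \<open>At a vertex with two neighbours, the full message can be split along either edge; comparing
  both splittings shows that \<open>D i\<close> does not see how the full message is composed.\<close>

lemma D_root:
  assumes x: "x \<in> pos_orthant" "x' \<in> pos_orthant" and eq: "comp i x i = comp i x' i"
  shows "D i x = D i x'"
proof (cases "is_leaf E i")
  case True
  then show ?thesis using L_leaf[OF True x eq] by (simp add: L_def)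
next
  case False
  obtain j where j: "j \<in> nbrs i" using ex_nbr by blast
  have "nbrs i \<noteq> {j}" using False by (auto simp: is_leaf_def vdegree_card)
  then obtain k where k: "k \<in> nbrs i" "k \<noteq> j" using j by blast
  have ij: "{i, j} \<in> E" "{i, k} \<in> E" "i \<noteq> j" "i \<noteq> k" using j k edge_neq by auto
  \<comment> \<open>An intermediate point: the messages at \<open>i\<close> and from
    \<open>j\<close> are those of \<open>x\<close>, the message from \<open>k\<close> is that of
    \<open>x'\<close>. Since the messages at \<open>i\<close> coincide, it agrees with
    \<open>x\<close> along one edge and with \<open>x'\<close> along the other.\<close>
  define s where "s = vupd (vupd (vupd 1 i (comp i x i)) j (comp i x j)) k (comp i x' k)"
  define y where "y = Psi i s"
  have "(1 :: real ^ 'v) \<in> pos_orthant" by (simp add: pos_orthant_def)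
  then have s: "s \<in> pos_orthant" unfolding s_def using comp_pos x by (intro vupd_pos) auto
  then have y: "y \<in> pos_orthant" by (simp add: y_def Psi_pos)
  have cy: "comp i y l = s $ l" for l using s by (simp add: y_def comp_Psi)
  have ys: "comp i y i = comp i x i" "comp i y j = comp i x j" "comp i y k = comp i x' k"
    using ij k by (auto simp: cy s_def)
  \<comment> \<open>The message from \<open>i\<close> to \<open>l\<close> is the full message at
    \<open>i\<close> divided by 1 + ratio i l times the message from \<open>l\<close>.\<close>
  have msg: "comp l z i = comp l z' i"
    if l: "{i, l} \<in> E" and z: "z \<in> pos_orthant" "z' \<in> pos_orthant"
      and "comp i z i = comp i z' i" "comp i z l = comp i z' l" for l z z'
  proof -
    have "1 + ratio i l * comp i z l > 0"
      using ratio_pos[OF l] comp_pos[OF z(1)] by (simp add: add_pos_pos)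
    then show ?thesis
      using comp_root_edge[OF l, of z] comp_root_edge[OF l, of z'] that(4,5) by simp
  qed
  have "comp j x i = comp j y i" by (rule msg[OF ij(1) x(1) y]) (simp_all add: ys)
  then have "D i x = D i y" by (rule D_edge[OF ij(1) x(1) y]) (simp add: ys)
  also have "comp k y i = comp k x' i" by (rule msg[OF ij(2) y x(2)]) (simp_all add: ys eq)
  then have "D i y = D i x'" by (rule D_edge[OF ij(2) y x(2)]) (simp add: ys)
  finally show ?thesis .
qed

text \<open>The other coordinates of the base point are set to 1 arbitrarily; by
  \<open>D_root\<close> only the message at \<open>i\<close> matters.\<close>

definition G :: "'v \<Rightarrow> real \<Rightarrow> real" where
  "G i u = D i (Psi i (vupd 1 i u))"

lemma one_pos: "(1 :: real ^ 'v) \<in> pos_orthant"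
  by (simp add: pos_orthant_def)

lemma D_G:
  assumes x: "x \<in> pos_orthant"
  shows "D i x = G i (comp i x i)"
proof -
  have s: "vupd 1 i (comp i x i) \<in> pos_orthant" using comp_pos[OF x] one_pos by (intro vupd_pos)
  show ?thesis unfolding G_def
    by (rule D_root[OF x Psi_pos[OF s]]) (simp add: comp_Psi[OF s])
qed

lemma continuous_G: "continuous_on {0<..} (G i)"
proof -
  have D: "continuous_on pos_orthant (D i)"
    unfolding D_def
    by (intro continuous_intros continuous_f f_C1) (use f_pos in fastforce)
  have "continuous_on {0<..} (\<lambda>u. vupd (1 :: real ^ 'v) i u)"
    unfolding vupd_def
  proof (rule continuous_on_vec_lambda)
    show "continuous_on {0<..} (\<lambda>u. if k = i then u else (1 :: real ^ 'v) $ k)" for k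
      by (cases "k = i") auto
  qed
  then have "continuous_on {0<..} (\<lambda>u. Psi i (vupd 1 i u))"
    by (rule continuous_on_compose2[OF continuous_Psi]) auto
  then show ?thesis unfolding G_def
    by (rule continuous_on_compose2[OF D]) (auto intro!: Psi_pos vupd_pos one_pos)
qed

text \<open>The messages \<open>a\<close> from \<open>j\<close> and \<open>b\<close> from
  \<open>i\<close> range freely over the positive numbers, and the root messages are b * (1 +
  \<alpha> * a) and a * (1 + \<beta> * b). Rescaling by the two ratios leads to
  \<open>kummer_functional_equation\<close>.\<close>

lemma G_edge:
  assumes ij: "{i, j} \<in> E"
  shows "\<exists>A B \<kappa>. \<forall>u>0. G i u = A - \<kappa> * C $ i $ i * u \<and> G j u = B - \<kappa> * C $ j $ j * u"
proof -
  have ji: "{j, i} \<in> E" using ij by (simp add: insert_commute)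
  have ne: "i \<noteq> j" using ij by (rule edge_neq)
  define \<alpha> \<beta> where "\<alpha> = ratio i j" and "\<beta> = ratio j i"
  have ab: "\<alpha> > 0" "\<beta> > 0" using ratio_pos[OF ij] ratio_pos[OF ji] by (simp_all add: \<alpha>_def \<beta>_def)
  define y where "y a b = Psi i (vupd (vupd 1 i (b * (1 + \<alpha> * a))) j a)" for a b
  have y: "y a b \<in> pos_orthant" "comp j (y a b) i = b" "comp i (y a b) j = a"
      "comp i (y a b) i = b * (1 + \<alpha> * a)" "comp j (y a b) j = a * (1 + \<beta> * b)"
    if "a > 0" "b > 0" for a b
  proof -
    have pos: "1 + \<alpha> * a > 0" using that ab by (simp add: add_pos_pos)
    let ?s = "vupd (vupd 1 i (b * (1 + \<alpha> * a))) j a"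
    have s: "?s \<in> pos_orthant" using that pos by (intro vupd_pos one_pos) auto
    then show y: "y a b \<in> pos_orthant" by (simp add: y_def Psi_pos)
    show c: "comp i (y a b) j = a" "comp i (y a b) i = b * (1 + \<alpha> * a)"
      using comp_Psi[OF s, of i] ne by (simp_all add: y_def)
    show cj: "comp j (y a b) i = b"
      using comp_root_edge[OF ij, of "y a b"] c pos by (simp add: \<alpha>_def)
    show "comp j (y a b) j = a * (1 + \<beta> * b)"
      using comp_root_edge[OF ji, of "y a b"] c cj by (simp add: \<beta>_def)
  qed
  \<comment> \<open>By \<open>L_edge\<close> the left side depends on \<open>b\<close> only; reading
    it off at a = 1 supplies the function \<open>H\<close>. The value at b = 1 in \<open>eqj\<close>
    supplies \<open>K\<close>.\<close>
  have eqi: "G i (b * (1 + \<alpha> * a)) - logistic (\<beta> * b) * G j (a * (1 + \<beta> * b)) =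
      G i (b * (1 + \<alpha>)) - logistic (\<beta> * b) * G j (1 + \<beta> * b)" if "a > 0" "b > 0" for a b
    using L_edge[OF ij y(1)[OF that] y(1)[OF zero_less_one that(2)]] that
    by (simp add: D_G y \<beta>_def)
  have eqj: "G j (a * (1 + \<beta> * b)) - logistic (\<alpha> * a) * G i (b * (1 + \<alpha> * a)) =
      G j (a * (1 + \<beta>)) - logistic (\<alpha> * a) * G i (1 + \<alpha> * a)" if "a > 0" "b > 0" for a b
    using L_edge[OF ji y(1)[OF that] y(1)[OF that(1) zero_less_one]] that
    by (simp add: D_G y \<alpha>_def)
  define F1 F2 where "F1 t = G i (t / \<beta>)" and "F2 t = G j (t / \<alpha>)" for t
  have "\<exists>A B k. \<forall>x>0. F1 x = A - k * x \<and> F2 x = B - k * x"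
  proof (rule kummer_functional_equation)
    show "continuous_on {0<..} F1" "continuous_on {0<..} F2"
      unfolding F1_def F2_def using ab
      by (auto intro!: continuous_on_compose2[OF continuous_G] continuous_intros)
    fix a b :: real assume pos: "a > 0" "b > 0"
    have r: "a / \<alpha> > 0" "b / \<beta> > 0" using pos ab by auto
    show "F1 (b * (1 + a)) = (G i (b / \<beta> * (1 + \<alpha>)) - logistic b * G j (1 + b)) +
        b / (1 + b) * F2 (a * (1 + b))"
      using eqi[OF r] ab by (simp add: F1_def F2_def logistic_def)
    show "F2 (a * (1 + b)) = (G j (a / \<alpha> * (1 + \<beta>)) - logistic a * G i (1 + a)) +
        a / (1 + a) * F1 (b * (1 + a))"
      using eqj[OF r] ab by (simp add: F1_def F2_def logistic_def)
  qed
  then obtain A B k where AB: "\<And>x. x > 0 \<Longrightarrow> F1 x = A - k * x \<and> F2 x = B - k * x" by blast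
  \<comment> \<open>By symmetry of \<open>C\<close>, \<beta> = C_ij / C_jj and \<alpha> = C_ij /
    C_ii, so the slopes k * \<beta> and k * \<alpha> are this \<kappa> times C_ii and C_jj.\<close>
  define \<kappa> where "\<kappa> = k * C $ i $ j / (C $ i $ i * C $ j $ j)"
  have "\<kappa> * C $ i $ i = k * \<beta>" "\<kappa> * C $ j $ j = k * \<alpha>"
    using C_diag[of i] C_diag[of j] C_sym[of i j] by (simp_all add: \<kappa>_def \<alpha>_def \<beta>_def ratio_def)
  moreover have "G i u = A - k * (\<beta> * u) \<and> G j u = B - k * (\<alpha> * u)" if "u > 0" for u
    using AB[of "\<beta> * u"] AB[of "\<alpha> * u"] that ab by (simp add: F1_def F2_def)
  ultimately show ?thesis
    by (intro exI[of _ A] exI[of _ B] exI[of _ \<kappa>]) simp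
qed

text \<open>The slope of \<open>G i\<close> is fixed by its values at 1 and 2, so after division by
  C_ii > 0 the constants of two edges at a vertex coincide. Connectedness spreads one constant over
  the tree.\<close>

lemma D_affine:
  "\<exists>A c. \<forall>x\<in>pos_orthant. \<forall>i. D i x = A i - c * C $ i $ i * comp i x i"
proof -
  obtain i0 j0 where "{i0, j0} \<in> E" using ex_nbr by blast
  then obtain A0 c where A0: "\<And>u. u > 0 \<Longrightarrow> G i0 u = A0 - c * C $ i0 $ i0 * u"
    using G_edge by metis
  have "\<exists>A. \<forall>u>0. G i u = A - c * C $ i $ i * u" for i
    using connected[of i0 i]
  proof (induction rule: rtrancl_induct)
    case base
    then show ?case using A0 by blast
  next
    case (step i j)
    then have ij: "{i, j} \<in> E" by (simp add: adj_rel_def)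
    obtain A where A: "\<And>u. u > 0 \<Longrightarrow> G i u = A - c * C $ i $ i * u" using step.IH by blast
    obtain A' B \<kappa> where \<kappa>: "\<And>u. u > 0 \<Longrightarrow> G i u = A' - \<kappa> * C $ i $ i * u"
        "\<And>u. u > 0 \<Longrightarrow> G j u = B - \<kappa> * C $ j $ j * u"
      using G_edge[OF ij] by metis
    have "c * C $ i $ i = \<kappa> * C $ i $ i"
      using A[of 1] A[of 2] \<kappa>(1)[of 1] \<kappa>(1)[of 2] by linarith
    then have "\<kappa> = c" using C_diag[of i] by simp
    then show ?case using \<kappa>(2) by blast
  qed
  then obtain A where "\<And>i u. u > 0 \<Longrightarrow> G i u = A i - c * C $ i $ i * u" by metis
  then show ?thesis using D_G comp_pos by (intro exI[of _ A] exI[of _ c]) auto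
qed

end

section \<open>Product densities\<close>

lemma nn_integral_inverse_unit: "(\<integral>\<^sup>+ t. ennreal (1 / t) * indicator {0<..<1} t \<partial>lborel) = \<infinity>"
proof (rule ccontr)
  let ?I = "\<integral>\<^sup>+ t. ennreal (1 / t) * indicator {0<..<1} t \<partial>lborel"
  assume "?I \<noteq> \<infinity>"
  then obtain K where K: "?I = ennreal K" "K \<ge> 0" by (cases ?I) auto
  define e where "e = exp (- (K + 1))"
  have e: "0 < e" "e < 1" using K by (simp_all add: e_def)
  have "(\<integral>\<^sup>+ t. ennreal (1 / t) * indicator {e..1} t \<partial>lborel) = ennreal (ln 1 - ln e)"
    using e by (intro nn_integral_FTC_Icc) (auto intro!: derivative_eq_intros)
  also have "\<dots> = ennreal (K + 1)" by (simp add: e_def add.commute)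
  finally have "ennreal (K + 1) = (\<integral>\<^sup>+ t. ennreal (1 / t) * indicator {e..1} t \<partial>lborel)" ..
  also have "\<dots> \<le> ?I"
  proof (rule nn_integral_mono_AE)
    show "AE t in lborel. ennreal (1 / t) * indicator {e..1} t \<le> ennreal (1 / t) * indicator {0<..<1} t"
      using AE_lborel_singleton[of "1::real"] by eventually_elim (use e in \<open>auto simp: indicator_def\<close>)
  qed
  finally show False using K by simp
qed

lemma nn_integral_inverse_tail: "(\<integral>\<^sup>+ t. ennreal (1 / t) * indicator {1..} t \<partial>lborel) = \<infinity>"
proof (rule ccontr)
  let ?I = "\<integral>\<^sup>+ t. ennreal (1 / t) * indicator {1..} t \<partial>lborel"
  assume "?I \<noteq> \<infinity>"
  then obtain K where K: "?I = ennreal K" "K \<ge> 0" by (cases ?I) auto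
  define e where "e = exp (K + 1)"
  have e: "1 \<le> e" using K by (simp add: e_def)
  have "(\<integral>\<^sup>+ t. ennreal (1 / t) * indicator {1..e} t \<partial>lborel) = ennreal (ln e - ln 1)"
    using e by (intro nn_integral_FTC_Icc) (auto intro!: derivative_eq_intros)
  also have "\<dots> = ennreal (K + 1)" by (simp add: e_def)
  finally have "ennreal (K + 1) = (\<integral>\<^sup>+ t. ennreal (1 / t) * indicator {1..e} t \<partial>lborel)" ..
  also have "\<dots> \<le> ?I"
    by (intro nn_integral_mono) (auto simp: indicator_def)
  finally show False using K by simp
qed

text \<open>For A \<le> -1 the function t powr A dominates 1 / t on the unit interval, where the
  integral diverges.\<close>

lemma powr_integrable_at_0:
  fixes h :: "real \<Rightarrow> real"
  assumes fin: "(\<integral>\<^sup>+ t. ennreal (h t) \<partial>lborel) \<noteq> \<infinity>" and K: "K > 0"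
    and h: "\<And>t. 0 < t \<Longrightarrow> t < 1 \<Longrightarrow> K * t powr A \<le> h t"
  shows "A > -1"
proof (rule ccontr)
  assume "\<not> A > -1"
  then have A: "A \<le> -1" by simp
  have "ennreal K * (\<integral>\<^sup>+ t. ennreal (1 / t) * indicator {0<..<1} t \<partial>lborel) =
      (\<integral>\<^sup>+ t. ennreal K * (ennreal (1 / t) * indicator {0<..<1} t) \<partial>lborel)"
    by (rule nn_integral_cmult[symmetric]) measurable
  also have "\<dots> \<le> (\<integral>\<^sup>+ t. ennreal (h t) \<partial>lborel)"
  proof (rule nn_integral_mono)
    fix t :: real
    show "ennreal K * (ennreal (1 / t) * indicator {0<..<1} t) \<le> ennreal (h t)"
    proof (cases "0 < t \<and> t < 1")
      case True
      then have "1 / t = t powr (-1)" by (simp add: powr_minus_divide)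
      also have "\<dots> \<le> t powr A" using True A by (intro powr_mono') auto
      finally have "K * (1 / t) \<le> h t" using h[of t] True K
        by (meson less_imp_le mult_left_mono order_trans)
      then show ?thesis using True K by (simp add: ennreal_leI flip: ennreal_mult')
    qed (auto simp: indicator_def)
  qed
  finally show False using fin K by (simp add: nn_integral_inverse_unit ennreal_mult_top top_unique)
qed

lemma dist_prop_to_emeasure:
  fixes h :: "'b::euclidean_space \<Rightarrow> real"
  assumes [measurable]: "h \<in> borel_measurable borel" "A \<in> sets borel"
  shows "emeasure (dist_prop_to h) A = (\<integral>\<^sup>+ x. ennreal (h x / (LINT y|lborel. h y)) * indicator A x \<partial>lborel)"
  unfolding dist_prop_to_def by (rule emeasure_density) measurable

text \<open>The constant \<open>K\<close> cancels against the normalizing integral, and the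
  substitution contributes \<rho>. If that integral is 0, both quotients are 0, so no case
  distinction arises.\<close>

lemma dist_prop_to_scale:
  fixes h w :: "real \<Rightarrow> real"
  assumes [measurable]: "w \<in> borel_measurable borel" and \<rho>: "\<rho> > 0" and K: "K \<noteq> 0"
    and h: "\<And>t. h t = K * w (\<rho> * t)"
  shows "distr (dist_prop_to h) borel (\<lambda>t. \<rho> * t) = dist_prop_to w"
proof (rule measure_eqI)
  have [measurable]: "h \<in> borel_measurable borel" unfolding h[abs_def] by measurable
  show "sets (distr (dist_prop_to h) borel (\<lambda>t. \<rho> * t)) = sets (dist_prop_to w)"
    by (simp add: dist_prop_to_def)
  fix A assume "A \<in> sets (distr (dist_prop_to h) borel (\<lambda>t. \<rho> * t))"
  then have A [measurable]: "A \<in> sets borel" by simp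
  define W where "W = (LINT y|lborel. w y)"
  have "W = \<rho> * (LINT t|lborel. w (0 + \<rho> * t))"
    using lborel_integral_real_affine[of \<rho> w 0] \<rho> by (simp add: W_def)
  then have H: "(LINT t|lborel. h t) = K * W / \<rho>" using \<rho> by (simp add: h[abs_def])
  have pre: "(\<lambda>t. \<rho> * t) -` A \<in> sets borel"
    using measurable_sets_borel[OF _ A, of "\<lambda>t. \<rho> * t"] by simp
  have "emeasure (distr (dist_prop_to h) borel (\<lambda>t. \<rho> * t)) A =
      emeasure (dist_prop_to h) ((\<lambda>t. \<rho> * t) -` A)"
    by (subst emeasure_distr) (auto simp: dist_prop_to_def)
  also have "\<dots> = (\<integral>\<^sup>+ t. ennreal (h t / (K * W / \<rho>)) * indicator ((\<lambda>t. \<rho> * t) -` A) t \<partial>lborel)"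
    using pre by (simp add: dist_prop_to_emeasure H)
  also have "\<dots> = (\<integral>\<^sup>+ t. ennreal \<rho> * (ennreal (w (0 + \<rho> * t) / W) * indicator A (0 + \<rho> * t)) \<partial>lborel)"
  proof (rule nn_integral_cong)
    fix t
    have "h t / (K * W / \<rho>) = \<rho> * (w (\<rho> * t) / W)" using K \<rho> by (simp add: h)
    moreover have "ennreal (\<rho> * (w (\<rho> * t) / W)) = ennreal \<rho> * ennreal (w (\<rho> * t) / W)"
      using \<rho> by (intro ennreal_mult') simp
    ultimately have "ennreal (h t / (K * W / \<rho>)) = ennreal \<rho> * ennreal (w (\<rho> * t) / W)" by simp
    then show "ennreal (h t / (K * W / \<rho>)) * indicator ((\<lambda>t. \<rho> * t) -` A) t =
        ennreal \<rho> * (ennreal (w (0 + \<rho> * t) / W) * indicator A (0 + \<rho> * t))"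
      by (simp add: indicator_def)
  qed
  also have "\<dots> = ennreal \<bar>\<rho>\<bar> * (\<integral>\<^sup>+ t. ennreal (w (0 + \<rho> * t) / W) * indicator A (0 + \<rho> * t) \<partial>lborel)"
    using \<rho> by (subst nn_integral_cmult) auto
  also have "\<dots> = (\<integral>\<^sup>+ t. ennreal (w t / W) * indicator A t \<partial>lborel)"
    using \<rho> by (intro nn_integral_real_affine[symmetric]) auto
  also have "\<dots> = emeasure (dist_prop_to w) A" by (simp add: dist_prop_to_emeasure W_def)
  finally show "emeasure (distr (dist_prop_to h) borel (\<lambda>t. \<rho> * t)) A = emeasure (dist_prop_to w) A" .
qed

text \<open>Total mass 1 reads \<open>R * T i = 1\<close> in the extended reals. This single
  equation makes \<open>T i\<close> finite and nonzero and identifies the normalizing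
  constant.\<close>

lemma (in prob_space) product_density_marginal:
  fixes S :: "'a \<Rightarrow> real ^ 'n" and h :: "'n \<Rightarrow> real \<Rightarrow> real"
  assumes S: "distributed M lborel S (\<lambda>s. ennreal (Z * (\<Prod>i\<in>UNIV. h i (s $ i))))"
    and Z: "Z > 0" and h0: "\<And>i t. h i t \<ge> 0" and [measurable]: "\<And>i. h i \<in> borel_measurable borel"
  shows "(\<integral>\<^sup>+ t. ennreal (h i t) \<partial>lborel) \<noteq> \<infinity>"
    and "distr M borel (\<lambda>\<omega>. S \<omega> $ i) = dist_prop_to (h i)"
proof -
  have [measurable]: "S \<in> borel_measurable M"
    using distributed_measurable[OF S] by simp
  define T where "T i = (\<integral>\<^sup>+ t. ennreal (h i t) \<partial>lborel)" for i
  define R where "R = ennreal Z * (\<Prod>j\<in>-{i}. T j)"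
  have prob: "emeasure M ((\<lambda>\<omega>. S \<omega> $ i) -` A \<inter> space M) =
      R * (\<integral>\<^sup>+ t. ennreal (h i t) * indicator A t \<partial>lborel)"
    if A [measurable]: "A \<in> sets borel" for A
  proof -
    have pre: "(\<lambda>s :: real ^ 'n. s $ i) -` A \<in> sets borel"
      using measurable_sets_borel[OF measurable_vec_nth[of i] A] by simp
    note [measurable] = pre
    let ?g = "\<lambda>j t. ennreal (h j t) * (if j = i then indicator A t else 1)"
    have "(\<lambda>\<omega>. S \<omega> $ i) -` A \<inter> space M = S -` ((\<lambda>s. s $ i) -` A) \<inter> space M" by auto
    then have "emeasure M ((\<lambda>\<omega>. S \<omega> $ i) -` A \<inter> space M) =
        (\<integral>\<^sup>+ s. ennreal (Z * (\<Prod>j\<in>UNIV. h j (s $ j))) * indicator ((\<lambda>s. s $ i) -` A) s \<partial>lborel)"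
      using distributed_emeasure[OF S, of "(\<lambda>s. s $ i) -` A"] pre by simp
    also have "\<dots> = (\<integral>\<^sup>+ s. ennreal Z * (\<Prod>j\<in>UNIV. ?g j (s $ j)) \<partial>lborel)"
    proof (rule nn_integral_cong)
      fix s :: "real ^ 'n"
      have "(\<Prod>j\<in>UNIV. ?g j (s $ j)) = ennreal (\<Prod>j\<in>UNIV. h j (s $ j)) * indicator A (s $ i)"
        unfolding prod.distrib by (simp add: prod_ennreal h0)
      then show "ennreal (Z * (\<Prod>j\<in>UNIV. h j (s $ j))) * indicator ((\<lambda>s. s $ i) -` A) s =
          ennreal Z * (\<Prod>j\<in>UNIV. ?g j (s $ j))"
        using Z by (simp add: ennreal_mult' prod_nonneg h0 indicator_def)
    qed
    also have "\<dots> = ennreal Z * (\<integral>\<^sup>+ s. (\<Prod>j\<in>UNIV. ?g j (s $ j)) \<partial>lborel)"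
      by (rule nn_integral_cmult) measurable
    also have "(\<integral>\<^sup>+ s. (\<Prod>j\<in>UNIV. ?g j (s $ j)) \<partial>lborel) = (\<Prod>j\<in>UNIV. \<integral>\<^sup>+ t. ?g j t \<partial>lborel)"
      by (rule nn_integral_lborel_vec_prod) measurable
    also have "\<dots> = (\<integral>\<^sup>+ t. ennreal (h i t) * indicator A t \<partial>lborel) * (\<Prod>j\<in>-{i}. T j)"
      by (subst prod.remove[of UNIV i]) (auto simp: T_def Compl_eq_Diff_UNIV intro!: prod.cong)
    finally show ?thesis by (simp add: R_def ac_simps)
  qed
  have one: "R * T i = 1"
    using prob[of UNIV] emeasure_space_1 by (simp add: T_def)
  then have "T i \<noteq> 0" "R \<noteq> 0" by auto
  with one show fin: "(\<integral>\<^sup>+ t. ennreal (h i t) \<partial>lborel) \<noteq> \<infinity>"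
    unfolding T_def by (auto simp: ennreal_mult_top)
  obtain \<tau> where \<tau>: "T i = ennreal \<tau>" "\<tau> \<ge> 0" using fin by (cases "T i") (auto simp: T_def)
  have \<tau>0: "\<tau> > 0" using \<tau> \<open>T i \<noteq> 0\<close> by (cases "\<tau> = 0") auto
  have lint: "(LINT t|lborel. h i t) = \<tau>"
    using \<tau> by (subst integral_eq_nn_integral) (auto simp: h0 T_def[symmetric])
  have R: "R = ennreal (1 / \<tau>)"
  proof -
    have "R * (ennreal \<tau> * ennreal (1 / \<tau>)) = ennreal (1 / \<tau>)"
      using one \<tau>(1) by (simp flip: mult.assoc)
    then show ?thesis using \<tau>0 by (simp flip: ennreal_mult')
  qed
  show "distr M borel (\<lambda>\<omega>. S \<omega> $ i) = dist_prop_to (h i)"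
  proof (rule measure_eqI)
    show "sets (distr M borel (\<lambda>\<omega>. S \<omega> $ i)) = sets (dist_prop_to (h i))"
      by (simp add: dist_prop_to_def)
    fix A assume "A \<in> sets (distr M borel (\<lambda>\<omega>. S \<omega> $ i))"
    then have A [measurable]: "A \<in> sets borel" by simp
    have "emeasure (distr M borel (\<lambda>\<omega>. S \<omega> $ i)) A = R * (\<integral>\<^sup>+ t. ennreal (h i t) * indicator A t \<partial>lborel)"
      using prob[OF A] by (subst emeasure_distr) auto
    also have "\<dots> = (\<integral>\<^sup>+ t. R * (ennreal (h i t) * indicator A t) \<partial>lborel)"
      by (rule nn_integral_cmult[symmetric]) measurable
    also have "\<dots> = (\<integral>\<^sup>+ t. ennreal (h i t / \<tau>) * indicator A t \<partial>lborel)"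
      using \<tau>0 by (intro nn_integral_cong) (simp add: R h0 flip: ennreal_mult' mult.assoc)
    also have "\<dots> = emeasure (dist_prop_to (h i)) A" by (simp add: dist_prop_to_emeasure lint)
    finally show "emeasure (distr M borel (\<lambda>\<omega>. S \<omega> $ i)) A = emeasure (dist_prop_to (h i)) A" .
  qed
qed

section \<open>Identification of the density\<close>

context leaf_independence
begin

text \<open>Up to a constant, the positive solution of t * g' / g = A_i - c * C_ii * t - logistic
  (\<rho> * t) * A_p, without the last term at the root. It is a factor of \<open>f\<close> alone;
  the Jacobian later turns the exponent - A_p into - A_p - 1.\<close>

definition tilt :: "('v \<Rightarrow> real) \<Rightarrow> real \<Rightarrow> 'v \<Rightarrow> 'v \<Rightarrow> real \<Rightarrow> real" where
  "tilt A c r i t = t powr A i * exp (- c * C $ i $ i * t) *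
     (if i = r then 1 else (1 + ratio (parent E r i) i * t) powr (- A (parent E r i)))"

lemma one_plus_pos: "i \<noteq> r \<Longrightarrow> t > 0 \<Longrightarrow> 1 + ratio (parent E r i) i * t > 0"
  using ratio_pos[OF parent_edge, of i r] by (simp add: add_pos_pos)

lemma tilt_pos: "t > 0 \<Longrightarrow> tilt A c r i t > 0"
  using one_plus_pos[of i r t] by (cases "i = r") (auto simp: tilt_def intro!: mult_pos_pos)

lemma tilt_deriv:
  assumes t: "t > 0"
  shows "(tilt A c r i has_real_derivative tilt A c r i t / t *
    (A i - c * C $ i $ i * t - (if i = r then 0
       else logistic (ratio (parent E r i) i * t) * A (parent E r i)))) (at t)"
proof -
  define \<rho> B \<kappa> where "\<rho> = ratio (parent E r i) i" and "B = A (parent E r i)" and "\<kappa> = c * C $ i $ i"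
  have d1: "((\<lambda>t. t powr A i * exp (- \<kappa> * t)) has_real_derivative
      t powr A i * exp (- \<kappa> * t) * (A i / t - \<kappa>)) (at t)"
    using t by (auto intro!: derivative_eq_intros simp: powr_diff field_simps)
  show ?thesis
  proof (cases "i = r")
    case True
    have "t powr A i * exp (- \<kappa> * t) * (A i / t - \<kappa>) = t powr A i * exp (- \<kappa> * t) / t * (A i - \<kappa> * t)"
      using t by (simp add: field_simps)
    then show ?thesis using d1 True by (simp add: tilt_def[abs_def] \<kappa>_def)
  next
    case False
    have pos: "1 + \<rho> * t > 0" using one_plus_pos[OF False t] by (simp add: \<rho>_def)
    have d2: "((\<lambda>t. (1 + \<rho> * t) powr (- B)) has_real_derivative
        (1 + \<rho> * t) powr (- B) * (- B * \<rho> / (1 + \<rho> * t))) (at t)"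
    proof -
      have "((\<lambda>t. 1 + \<rho> * t) has_real_derivative \<rho>) (at t)" by (auto intro!: derivative_eq_intros)
      from DERIV_fun_powr[OF this pos, of "- B"] show ?thesis
        using pos by (simp add: powr_diff ac_simps)
    qed
    have "(tilt A c r i has_real_derivative
        t powr A i * exp (- \<kappa> * t) * (A i / t - \<kappa>) * (1 + \<rho> * t) powr (- B) +
        (1 + \<rho> * t) powr (- B) * (- B * \<rho> / (1 + \<rho> * t)) * (t powr A i * exp (- \<kappa> * t))) (at t)"
      using DERIV_mult[OF d1 d2] False by (simp add: tilt_def[abs_def] \<rho>_def B_def \<kappa>_def)
    moreover have "t powr A i * exp (- \<kappa> * t) * (A i / t - \<kappa>) * (1 + \<rho> * t) powr (- B) +
          (1 + \<rho> * t) powr (- B) * (- B * \<rho> / (1 + \<rho> * t)) * (t powr A i * exp (- \<kappa> * t)) =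
        tilt A c r i t / t * (A i - \<kappa> * t - logistic (\<rho> * t) * B)"
    proof -
      have "t powr A i * exp (- \<kappa> * t) * (A i / t - \<kappa>) * (1 + \<rho> * t) powr (- B) +
          (1 + \<rho> * t) powr (- B) * (- B * \<rho> / (1 + \<rho> * t)) * (t powr A i * exp (- \<kappa> * t)) =
          (t powr A i * exp (- \<kappa> * t) * (1 + \<rho> * t) powr (- B)) *
            (A i / t - \<kappa> - B * \<rho> / (1 + \<rho> * t))"
        by (simp add: algebra_simps)
      also have "A i / t - \<kappa> - B * \<rho> / (1 + \<rho> * t) = (A i - \<kappa> * t - logistic (\<rho> * t) * B) / t"
        using t pos by (simp add: logistic_def diff_divide_distrib)
      also have "t powr A i * exp (- \<kappa> * t) * (1 + \<rho> * t) powr (- B) = tilt A c r i t"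
        using False by (simp add: tilt_def \<rho>_def B_def \<kappa>_def)
      finally show ?thesis by simp
    qed
    ultimately have "(tilt A c r i has_real_derivative
        tilt A c r i t / t * (A i - \<kappa> * t - logistic (\<rho> * t) * B)) (at t)"
      by (simp only:)
    then show ?thesis using False by (simp add: \<rho>_def B_def \<kappa>_def)
  qed
qed

text \<open>Since \<open>L r i\<close> is the logarithmic derivative of \<open>tilt\<close>, the
  quotient \<open>R\<close> does not change when one coordinate moves. Moving the coordinates one by
  one away from the all-ones vector shows that it is constant.\<close>

lemma f_Psi_product:
  assumes D: "\<And>x i. x \<in> pos_orthant \<Longrightarrow> D i x = A i - c * C $ i $ i * comp i x i"
  shows "\<exists>Z>0. \<forall>s\<in>pos_orthant. f (Psi r s) = Z * (\<Prod>i\<in>UNIV. tilt A c r i (s $ i))"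
proof -
  have L: "L r i (Psi r s) = A i - c * C $ i $ i * s $ i - (if i = r then 0
       else logistic (ratio (parent E r i) i * s $ i) * A (parent E r i))"
    if s: "s \<in> pos_orthant" for s i
  proof -
    define x where "x = Psi r s"
    have x: "x \<in> pos_orthant" using s by (simp add: x_def Psi_pos)
    have cs: "comp r x i = s $ i" using s by (simp add: x_def comp_Psi)
    have si: "s $ i > 0" using s by (simp add: pos_orthant_def)
    show ?thesis
    proof (cases "i = r")
      case True
      then show ?thesis using D[OF x, of i] cs by (simp add: L_def flip: x_def)
    next
      case False
      define p where "p = parent E r i"
      have e: "{p, i} \<in> E" "{i, p} \<in> E"
        using parent_edge[OF False] by (simp_all add: p_def insert_commute)
      have pi: "comp p x i = s $ i" using comp_parent_nbr[OF False, of x] cs by (simp add: p_def)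
      define \<tau> where "\<tau> = comp i x p"
      have ui: "comp i x i = s $ i * (1 + ratio i p * \<tau>)"
        using comp_root_edge[OF e(2), of x] pi by (simp add: \<tau>_def)
      have up: "comp p x p = \<tau> * (1 + ratio p i * s $ i)"
        using comp_root_edge[OF e(1), of x] pi by (simp add: \<tau>_def)
      have pos: "1 + ratio p i * s $ i > 0" using ratio_pos[OF e(1)] si by (simp add: add_pos_pos)
      \<comment> \<open>Both sides equal C_ip. Hence the terms with the opposite message \<tau>
        cancel and only s_i survives.\<close>
      have "C $ i $ i * ratio i p = C $ p $ p * ratio p i"
        using C_sym[of i p] C_diag[of i] C_diag[of p] by (simp add: ratio_def)
      moreover have "logistic (ratio p i * s $ i) * (C $ p $ p * comp p x p) = C $ p $ p * ratio p i * s $ i * \<tau>"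
        using pos by (simp add: logistic_def up)
      ultimately have "C $ i $ i * comp i x i - logistic (ratio p i * s $ i) * (C $ p $ p * comp p x p) =
          C $ i $ i * s $ i"
        unfolding ui by algebra
      then have "c * (C $ i $ i * comp i x i - logistic (ratio p i * s $ i) * (C $ p $ p * comp p x p)) =
          c * (C $ i $ i * s $ i)" by simp
      moreover have "L r i x = D i x - logistic (ratio p i * s $ i) * D p x"
        using False cs by (simp add: L_def p_def)
      ultimately have "L r i x = A i - c * C $ i $ i * s $ i - logistic (ratio p i * s $ i) * A p"
        using D[OF x, of i] D[OF x, of p] by (simp add: algebra_simps)
      then show ?thesis using False by (simp add: x_def p_def)
    qed
  qed
  define R where "R s = f (Psi r s) / (\<Prod>i\<in>UNIV. tilt A c r i (s $ i))" for s
  have R_vupd: "R (vupd s i t) = R s" if s: "s \<in> pos_orthant" and t: "t > 0" for s i t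
  proof -
    define \<phi> where "\<phi> t = f (Psi r (vupd s i t)) / tilt A c r i t" for t
    have "(\<phi> has_real_derivative 0) (at t within {0<..})" if "t \<in> {0<..}" for t
    proof -
      have t: "t > 0" using that by simp
      let ?K = "f (Psi r (vupd s i t))" and ?g = "tilt A c r i t" and ?L = "L r i (Psi r (vupd s i t))"
      have d: "((\<lambda>u. f (Psi r (vupd s i u))) has_real_derivative ?K / t * ?L) (at t)"
        using f_Psi_deriv[OF vupd_pos[OF s t, of i], of r i] by simp
      have g: "(tilt A c r i has_real_derivative ?g / t * ?L) (at t)"
        using tilt_deriv[OF t, of A c r i] L[OF vupd_pos[OF s t, of i], of i] by (cases "i = r") simp_all
      have "?g \<noteq> 0" using tilt_pos[OF t] less_imp_neq by metis
      from DERIV_divide[OF d g this] have "(\<phi> has_real_derivative 0) (at t)"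
        by (simp add: \<phi>_def[abs_def] ac_simps)
      then show ?thesis by (rule has_field_derivative_at_within)
    qed
    then obtain k where "\<And>t. t > 0 \<Longrightarrow> \<phi> t = k"
      using has_field_derivative_zero_constant[of "{0<..} :: real set" \<phi>] by (auto simp: convex_real_interval)
    then have "\<phi> t = \<phi> (s $ i)" using t s by (simp add: pos_orthant_def)
    moreover have "R (vupd s i u) = \<phi> u / (\<Prod>j\<in>-{i}. tilt A c r j (s $ j))" for u
    proof -
      have "(\<Prod>j\<in>UNIV. tilt A c r j (vupd s i u $ j)) = tilt A c r i u * (\<Prod>j\<in>-{i}. tilt A c r j (s $ j))"
        by (subst prod.remove[of UNIV i]) (auto simp: Compl_eq_Diff_UNIV intro!: prod.cong)
      then show ?thesis by (simp add: R_def \<phi>_def)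
    qed
    from this[of t] this[of "s $ i"] \<open>\<phi> t = \<phi> (s $ i)\<close> show ?thesis by simp
  qed
  have R_const: "R s = R 1" if s: "s \<in> pos_orthant" for s
  proof -
    define mix where "mix B = (\<chi> i. if i \<in> B then s $ i else 1)" for B
    have "R (mix B) = R 1" for B
      using finite[of B]
    proof (induction B rule: finite_induct)
      case empty
      have "mix {} = 1" by (simp add: mix_def vec_eq_iff)
      then show ?case by simp
    next
      case (insert i B)
      have "mix (insert i B) = vupd (mix B) i (s $ i)" by (simp add: mix_def vec_eq_iff)
      moreover have "mix B \<in> pos_orthant" "s $ i > 0" using s by (auto simp: mix_def pos_orthant_def)
      ultimately show ?case using R_vupd insert.IH by simp
    qed
    moreover have "mix UNIV = s" by (simp add: mix_def vec_eq_iff)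
    ultimately show ?thesis by metis
  qed
  have prod_pos: "(\<Prod>i\<in>UNIV. tilt A c r i (s $ i)) > 0" if "s \<in> pos_orthant" for s
    using that by (intro prod_pos tilt_pos) (auto simp: pos_orthant_def)
  show ?thesis
  proof (intro exI[of _ "R 1"] conjI ballI)
    show "R 1 > 0"
      unfolding R_def using f_pos[OF Psi_pos[OF one_pos]] prod_pos[OF one_pos] by (rule divide_pos_pos)
    fix s :: "real ^ 'v" assume s: "s \<in> pos_orthant"
    show "f (Psi r s) = R 1 * (\<Prod>i\<in>UNIV. tilt A c r i (s $ i))"
    proof -
      have cancel: "u = u / v * v" if "v > 0" for u v :: real using that by simp
      show ?thesis unfolding R_const[OF s, symmetric] unfolding R_def by (rule cancel[OF prod_pos[OF s]])
    qed
  qed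
qed

lemma ex_leaf: "\<exists>r. is_leaf E r"
proof -
  obtain i j :: 'v where "{i, j} \<in> E" using ex_nbr by blast
  then show ?thesis using leaf_behind_edge by blast
qed

section \<open>Marginal laws and the signs of the parameters\<close>

definition marginal :: "('v \<Rightarrow> real) \<Rightarrow> real \<Rightarrow> 'v \<Rightarrow> 'v \<Rightarrow> real \<Rightarrow> real" where
  "marginal A c r i t = tilt A c r i t *
     (if i = r then 1 else 1 / (1 + ratio (parent E r i) i * \<bar>t\<bar>)) * indicator {0<..} t"

lemma measurable_marginal [measurable]: "marginal A c r i \<in> borel_measurable borel"
  unfolding marginal_def tilt_def by measurable

lemma marginal_nonneg: "marginal A c r i t \<ge> 0"
proof (cases "t > 0")
  case True
  then show ?thesis
    using tilt_pos[OF True, of A c r i] one_plus_pos[of i r t]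
    by (auto simp: marginal_def less_imp_le)
qed (simp add: marginal_def)

lemma marginal_root:
  "marginal A c r r t = t powr (A r + 1 - 1) * exp (- (c * C $ r $ r) * t) * indicator {0<..} t"
  by (simp add: marginal_def tilt_def)

lemma marginal_nonroot:
  assumes i: "i \<noteq> r" and t: "t > 0" and p: "p = parent E r i"
  shows "marginal A c r i t = t powr A i * exp (- c * C $ i $ i * t) * (1 + ratio p i * t) powr (- A p - 1)"
  using one_plus_pos[OF i t] i t
  by (simp add: marginal_def tilt_def p powr_diff)

lemma density_factorizes:
  assumes f: "\<And>s. s \<in> pos_orthant \<Longrightarrow> f (Psi r s) = Z * (\<Prod>i\<in>UNIV. tilt A c r i (s $ i))"
  shows "f (Psi r s) * jac r s = Z * (\<Prod>i\<in>UNIV. marginal A c r i (s $ i))"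
proof (cases "s \<in> pos_orthant")
  case True
  have "jac r s = (\<Prod>i\<in>UNIV. if i = r then 1 else 1 / (1 + ratio (parent E r i) i * \<bar>s $ i\<bar>))"
    unfolding jac_edges by (rule prod.mono_neutral_cong_left) auto
  moreover have "marginal A c r i (s $ i) = tilt A c r i (s $ i) *
      (if i = r then 1 else 1 / (1 + ratio (parent E r i) i * \<bar>s $ i\<bar>))" for i
    using True by (simp add: marginal_def pos_orthant_def)
  ultimately show ?thesis using f[OF True] by (simp only: prod.distrib mult.assoc)
next
  case False
  then obtain i where "\<not> 0 < s $ i" by (auto simp: pos_orthant_def)
  then have "marginal A c r i (s $ i) = 0" by (simp add: marginal_def)
  then have "(\<Prod>i\<in>UNIV. marginal A c r i (s $ i)) = 0" by (intro prod_zero) auto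
  moreover have "f (Psi r s) = 0" using False by (simp add: f_zero Psi_pos_iff)
  ultimately show ?thesis by simp
qed

text \<open>On the unit interval the exponential and the power of 1 + \<rho> * t stay above positive
  constants; the absolute values in these constants cover either sign of the parameters.
  Integrability will then force A i > -1.\<close>

lemma marginal_powr_bound:
  "\<exists>K>0. \<forall>t. 0 < t \<longrightarrow> t < 1 \<longrightarrow> K * t powr A i \<le> marginal A c r i t"
proof -
  define \<kappa> where "\<kappa> = c * C $ i $ i"
  have ex: "exp (- \<bar>\<kappa>\<bar>) \<le> exp (- c * C $ i $ i * t)" if "0 < t" "t < 1" for t
  proof -
    have "\<kappa> * t \<le> \<bar>\<kappa>\<bar> * 1" using that by (intro mult_mono) auto
    then show ?thesis by (simp add: \<kappa>_def)
  qed
  show ?thesis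
  proof (cases "i = r")
    case True
    show ?thesis
    proof (intro exI[of _ "exp (- \<bar>\<kappa>\<bar>)"] conjI allI impI)
      fix t :: real assume t: "0 < t" "t < 1"
      have "exp (- \<bar>\<kappa>\<bar>) * t powr A i \<le> exp (- c * C $ i $ i * t) * t powr A i"
        using ex[OF t] by (intro mult_right_mono) auto
      then show "exp (- \<bar>\<kappa>\<bar>) * t powr A i \<le> marginal A c r i t"
        using t True by (simp add: marginal_def tilt_def ac_simps)
    qed simp
  next
    case False
    define p y \<rho> where "p = parent E r i" and "y = - A p - 1" and "\<rho> = ratio p i"
    have \<rho>: "\<rho> > 0" using ratio_pos[OF parent_edge[OF False]] by (simp add: \<rho>_def p_def)
    have pw: "(1 + \<rho>) powr (- \<bar>y\<bar>) \<le> (1 + \<rho> * t) powr y" if "0 < t" "t < 1" for t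
    proof -
      have "(1 + \<rho>) powr (- \<bar>y\<bar>) \<le> (1 + \<rho> * t) powr (- \<bar>y\<bar>)"
        using that \<rho> by (intro powr_mono2') (auto simp: add_pos_pos)
      also have "\<dots> \<le> (1 + \<rho> * t) powr y"
        using that \<rho> by (intro powr_mono) auto
      finally show ?thesis .
    qed
    show ?thesis
    proof (intro exI[of _ "exp (- \<bar>\<kappa>\<bar>) * (1 + \<rho>) powr (- \<bar>y\<bar>)"] conjI allI impI)
      show "exp (- \<bar>\<kappa>\<bar>) * (1 + \<rho>) powr (- \<bar>y\<bar>) > 0" using \<rho> by simp
      fix t :: real assume t: "0 < t" "t < 1"
      have "exp (- \<bar>\<kappa>\<bar>) * (1 + \<rho>) powr (- \<bar>y\<bar>) * t powr A i \<le>
          exp (- c * C $ i $ i * t) * (1 + \<rho> * t) powr y * t powr A i"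
        using ex[OF t] pw[OF t] by (intro mult_right_mono mult_mono) auto
      then show "exp (- \<bar>\<kappa>\<bar>) * (1 + \<rho>) powr (- \<bar>y\<bar>) * t powr A i \<le> marginal A c r i t"
        unfolding marginal_nonroot[OF False t(1) p_def] by (simp add: y_def \<rho>_def ac_simps)
    qed
  qed
qed

text \<open>The root marginal carries no power of 1 + \<rho> * t. For c \<le> 0 it would therefore
  dominate t powr A r, and hence 1 / t, for t \<ge> 1.\<close>

lemma rate_pos:
  assumes fin: "(\<integral>\<^sup>+ t. ennreal (marginal A c r r t) \<partial>lborel) \<noteq> \<infinity>" and A: "A r > -1"
  shows "c > 0"
proof (rule ccontr)
  assume "\<not> c > 0"
  then have c: "c * C $ r $ r \<le> 0" using C_diag[of r] by (simp add: mult_nonpos_nonneg)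
  have "(\<integral>\<^sup>+ t. ennreal (1 / t) * indicator {1..} t \<partial>lborel) \<le> (\<integral>\<^sup>+ t. ennreal (marginal A c r r t) \<partial>lborel)"
  proof (rule nn_integral_mono)
    fix t :: real
    show "ennreal (1 / t) * indicator {1..} t \<le> ennreal (marginal A c r r t)"
    proof (cases "t \<ge> 1")
      case True
      have "1 / t = t powr (-1)" using True by (simp add: powr_minus_divide)
      also have "\<dots> \<le> t powr A r" using True A by (intro powr_mono) auto
      also have "\<dots> = t powr A r * 1" by simp
      also have "\<dots> \<le> t powr A r * exp (- (c * C $ r $ r) * t)"
        using True c by (intro mult_left_mono) (auto simp: mult_nonpos_nonneg)
      also have "\<dots> = marginal A c r r t" using True by (simp add: marginal_root)
      finally show ?thesis using True by (simp add: ennreal_leI)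
    qed simp
  qed
  then show False using fin by (simp add: nn_integral_inverse_tail top_unique)
qed

text \<open>Collected at the parent \<open>i\<close>, the edge factors form
  \<open>den r s i powr (- A i)\<close>, exactly what changes s_i powr A_i into x_i powr
  A_i.\<close>

lemma tilt_product:
  assumes x: "x \<in> pos_orthant"
  shows "(\<Prod>i\<in>UNIV. tilt A c r i (comp r x i)) =
    (\<Prod>i\<in>UNIV. x $ i powr A i) * exp (- (c * (\<Sum>i\<in>UNIV. C $ i $ i * comp r x i)))"
proof -
  define s where "s = Phi E C r x"
  have s: "s \<in> pos_orthant" using x by (simp add: s_def Phi_pos)
  have si: "s $ i > 0" for i using s by (simp add: pos_orthant_def)
  have xs: "x $ i = s $ i / den r s i" for i
    using Psi_Phi[OF x, of r] Psi_nth[of r s i] by (simp add: s_def)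
  have "(\<Prod>i\<in>UNIV. if i = r then 1 else (1 + ratio (parent E r i) i * s $ i) powr (- A (parent E r i))) =
      (\<Prod>i\<in>-{r}. (1 + ratio (parent E r i) i * s $ i) powr (- A (parent E r i)))"
    by (rule prod.mono_neutral_cong_right) auto
  also have "\<dots> = (\<Prod>i\<in>UNIV. \<Prod>j\<in>children E r i. (1 + ratio i j * s $ j) powr (- A i))"
    by (rule prod_children[symmetric])
  also have "\<dots> = (\<Prod>i\<in>UNIV. den r s i powr (- A i))"
  proof (rule prod.cong)
    fix i
    have "den r s i = (\<Prod>j\<in>children E r i. 1 + ratio i j * s $ j)"
      unfolding den_def using si by (intro prod.cong) (auto simp: less_imp_le)
    then show "(\<Prod>j\<in>children E r i. (1 + ratio i j * s $ j) powr (- A i)) = den r s i powr (- A i)"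
      using si ratio_child
      by (simp add: prod_powr_distrib less_imp_le add_nonneg_nonneg)
  qed simp
  finally have edges: "(\<Prod>i\<in>UNIV. if i = r then 1
      else (1 + ratio (parent E r i) i * s $ i) powr (- A (parent E r i))) = (\<Prod>i\<in>UNIV. den r s i powr (- A i))" .
  have "x $ i powr A i = s $ i powr A i * den r s i powr (- A i)" for i
    using si[of i] den_pos[of r s i] by (simp add: xs powr_divide powr_minus_divide less_imp_le)
  then have prod_x: "(\<Prod>i\<in>UNIV. x $ i powr A i) =
      (\<Prod>i\<in>UNIV. s $ i powr A i) * (\<Prod>i\<in>UNIV. den r s i powr (- A i))"
    by (simp add: prod.distrib)
  have "exp (- (c * (\<Sum>i\<in>UNIV. C $ i $ i * s $ i))) = (\<Prod>i\<in>UNIV. exp (- c * C $ i $ i * s $ i))"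
    by (simp add: sum_distrib_left sum_negf[symmetric] ac_simps flip: exp_sum)
  then have "(\<Prod>i\<in>UNIV. tilt A c r i (s $ i)) =
      (\<Prod>i\<in>UNIV. x $ i powr A i) * exp (- (c * (\<Sum>i\<in>UNIV. C $ i $ i * s $ i)))"
    by (simp add: tilt_def prod.distrib edges prod_x ac_simps)
  then show ?thesis by (simp add: s_def)
qed

end

text \<open>The ratios, and with them the messages, are invariant under scaling of \<open>C\<close>;
  only the diagonal coefficients pick up \<open>c\<close>.\<close>

lemma (in weighted_tree) exponent_scale:
  assumes c: "c > 0"
  shows "tree_kummer_exponent E (c *\<^sub>R C) x = c * (\<Sum>i\<in>UNIV. C $ i $ i * comp r x i)"
proof -
  have "c *\<^sub>R C \<in> tree_matrices E"
  proof -
    have "transpose (c *\<^sub>R C) = c *\<^sub>R transpose C" by (simp add: transpose_def vec_eq_iff)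
    then show ?thesis using C c by (simp add: tree_matrices_def)
  qed
  then interpret scaled: weighted_tree E "c *\<^sub>R C" by unfold_locales
  have "scaled.ratio i j = ratio i j" for i j
    using c by (simp add: scaled.ratio_def ratio_def)
  then have "scaled.comp r x i = comp r x i" for i
  proof (induction i rule: children_induct[of r])
    case (step i)
    then show ?case by (subst scaled.comp_rec, subst comp_rec) (simp cong: prod.cong)
  qed
  then show ?thesis
    using scaled.exponent_eq_sum_comp[of x r] by (simp add: sum_distrib_left mult.assoc)
qed

theorem theorem4:
  fixes E :: "'v::finite set set"
    and C :: "real ^ 'v ^ 'v"
    and M :: "'w measure"
    and X :: "'w \<Rightarrow> real ^ 'v"
    and f :: "real ^ 'v \<Rightarrow> real"
    and grad_f :: "real ^ 'v \<Rightarrow> real ^ 'v"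
  assumes tree: "is_tree (UNIV :: 'v set) E"
    and size: "CARD('v) \<ge> 2"
    and C: "C \<in> tree_matrices E"
    and M: "prob_space M"
    and X_density: "distributed M lborel X (\<lambda>x. ennreal (f x))"
    and f_pos: "\<And>x. x \<in> pos_orthant \<Longrightarrow> f x > 0"
    and f_zero: "\<And>x. x \<notin> pos_orthant \<Longrightarrow> f x = 0"
    and f_deriv: "\<And>x. x \<in> pos_orthant \<Longrightarrow> GDERIV f x :> grad_f x"
    and f_C1: "continuous_on pos_orthant grad_f"
    and indep: "\<And>r. is_leaf E r \<Longrightarrow>
      prob_space.indep_vars M (\<lambda>_. borel) (\<lambda>i \<omega>. Phi E C r (X \<omega>) $ i) UNIV"
  shows "\<exists>(a :: real ^ 'v) (c :: real). (\<forall>i. a $ i > 0) \<and> c > 0 \<and>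
    (\<forall>r. is_leaf E r \<longrightarrow>
      distr M borel (\<lambda>\<omega>. Phi E C r (X \<omega>) $ r) = gamma_dist (a $ r) (c * C $ r $ r) \<and>
      (\<forall>i. i \<noteq> r \<longrightarrow> (let p = parent E r i in
        distr M borel (\<lambda>\<omega>. C $ p $ i / C $ p $ p * Phi E C r (X \<omega>) $ i) =
          kummer_dist (a $ i) (a $ p - a $ i) (c * (C $ p $ p * C $ i $ i / C $ p $ i))))) \<and>
    distr M borel X = tree_kummer_dist E a (c *\<^sub>R C)"
proof -
  interpret leaf_independence E C M X f grad_f
    using assms
    by (intro leaf_independence.intro weighted_tree.intro finite_tree.intro
        weighted_tree_axioms.intro leaf_independence_axioms.intro) auto
  have [measurable]: "X \<in> borel_measurable M"
    using distributed_measurable[OF X_density] by simp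
  have f_meas [measurable]: "f \<in> borel_measurable borel"
    using distributed_real_measurable[OF _ X_density] f_nonneg by simp
  obtain A c where D: "\<And>x i. x \<in> pos_orthant \<Longrightarrow> D i x = A i - c * C $ i $ i * comp i x i"
    using D_affine by blast
  define a :: "real ^ 'v" where "a = (\<chi> i. A i + 1)"
  have a: "a $ i = A i + 1" for i by (simp add: a_def)
  \<comment> \<open>Available for every root, leaf or not, because \<open>D\<close> no longer refers
    to leaves.\<close>
  have fin: "(\<integral>\<^sup>+ t. ennreal (marginal A c r i t) \<partial>lborel) \<noteq> \<infinity>"
    and law: "distr M borel (\<lambda>\<omega>. Phi E C r (X \<omega>) $ i) = dist_prop_to (marginal A c r i)" for r i
  proof -
    obtain Z where Z: "Z > 0" "\<And>s. s \<in> pos_orthant \<Longrightarrow> f (Psi r s) = Z * (\<Prod>i\<in>UNIV. tilt A c r i (s $ i))"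
      using f_Psi_product[OF D, of r] by blast
    have "distributed M lborel (\<lambda>\<omega>. Phi E C r (X \<omega>)) (\<lambda>s. ennreal (f (Psi r s) * jac r s))"
      by (rule distributed_Phi[OF X_density f_nonneg f_zero])
    then have "distributed M lborel (\<lambda>\<omega>. Phi E C r (X \<omega>))
        (\<lambda>s. ennreal (Z * (\<Prod>i\<in>UNIV. marginal A c r i (s $ i))))"
      by (simp only: density_factorizes[OF Z(2)])
    from product_density_marginal[OF this Z(1) marginal_nonneg measurable_marginal]
    show "(\<integral>\<^sup>+ t. ennreal (marginal A c r i t) \<partial>lborel) \<noteq> \<infinity>"
      "distr M borel (\<lambda>\<omega>. Phi E C r (X \<omega>) $ i) = dist_prop_to (marginal A c r i)" .
  qed
  obtain r0 where r0: "is_leaf E r0" using ex_leaf by blast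
  have A: "A i > -1" for i
  proof -
    obtain K where "K > 0" "\<And>t. 0 < t \<Longrightarrow> t < 1 \<Longrightarrow> K * t powr A i \<le> marginal A c r0 i t"
      using marginal_powr_bound by metis
    then show ?thesis using powr_integrable_at_0[OF fin] by blast
  qed
  have c: "c > 0" using rate_pos[OF fin A] .
  have gamma: "distr M borel (\<lambda>\<omega>. Phi E C r (X \<omega>) $ r) = gamma_dist (a $ r) (c * C $ r $ r)" for r
    unfolding law gamma_dist_def a by (intro arg_cong[where f = dist_prop_to] ext marginal_root)
  have kummer: "distr M borel (\<lambda>\<omega>. C $ p $ i / C $ p $ p * Phi E C r (X \<omega>) $ i) =
      kummer_dist (a $ i) (a $ p - a $ i) (c * (C $ p $ p * C $ i $ i / C $ p $ i))"
    if i: "i \<noteq> r" and p: "p = parent E r i" for r i p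
  proof -
    define \<rho> where "\<rho> = ratio p i"
    have e: "{p, i} \<in> E" using parent_edge[OF i] p by simp
    have \<rho>: "\<rho> > 0" using ratio_pos[OF e] by (simp add: \<rho>_def)
    let ?\<gamma> = "c * (C $ p $ p * C $ i $ i / C $ p $ i)"
    let ?w = "\<lambda>x. x powr (a $ i - 1) / (1 + x) powr (a $ i + (a $ p - a $ i)) * exp (- ?\<gamma> * x) * indicator {0<..} x"
    have \<gamma>: "?\<gamma> * (\<rho> * t) = c * C $ i $ i * t" for t
      using C_edge[OF e] C_diag[of p] by (simp add: \<rho>_def ratio_def)
    \<comment> \<open>Passing to \<rho> * t leaves the constant \<rho> powr (- A i). The exponent A
      p + 1 = a_p is written a_i + (a_p - a_i), which is the origin of the second Kummer
      parameter.\<close>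
    have scale: "marginal A c r i t = \<rho> powr (- A i) * ?w (\<rho> * t)" for t
    proof (cases "t > 0")
      case True
      have "(\<rho> * t) powr A i = \<rho> powr A i * t powr A i" using \<rho> True by (simp add: powr_mult)
      moreover have "\<rho> powr (- A i) * \<rho> powr A i = 1" using \<rho> by (simp flip: powr_add)
      ultimately have t: "t powr A i = \<rho> powr (- A i) * (\<rho> * t) powr A i" by simp
      have "- A p - 1 = - (A p + 1)" by simp
      then have pw: "(1 + \<rho> * t) powr (- A p - 1) = 1 / (1 + \<rho> * t) powr (A p + 1)"
        by (simp only: powr_minus_divide)
      then show ?thesis
        using \<rho> True \<gamma>[of t] unfolding marginal_nonroot[OF i True p] t \<rho>_def[symmetric] pw a
        by (simp add: add.commute[of "A p"])
    next
      case False
      then show ?thesis using \<rho> by (simp add: marginal_def zero_less_mult_iff)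
    qed
    have "(\<lambda>\<omega>. Phi E C r (X \<omega>) $ i) \<in> borel_measurable M" by measurable
    then have "distr M borel (\<lambda>\<omega>. \<rho> * Phi E C r (X \<omega>) $ i) =
        distr (distr M borel (\<lambda>\<omega>. Phi E C r (X \<omega>) $ i)) borel (\<lambda>t. \<rho> * t)"
      by (subst distr_distr) (auto simp: o_def)
    also have "\<dots> = dist_prop_to ?w"
      unfolding law
    proof (rule dist_prop_to_scale[where K = "\<rho> powr (- A i)"])
      show "marginal A c r i t = \<rho> powr (- A i) * ?w (\<rho> * t)" for t by (rule scale)
      show "?w \<in> borel_measurable borel" by measurable
    qed (use \<rho> in auto)
    finally show ?thesis unfolding kummer_dist_def \<rho>_def ratio_def .
  qed
  have TK: "distr M borel X = tree_kummer_dist E a (c *\<^sub>R C)"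
  proof -
    obtain Z where Z: "Z > 0" "\<And>s. s \<in> pos_orthant \<Longrightarrow> f (Psi r0 s) = Z * (\<Prod>i\<in>UNIV. tilt A c r0 i (s $ i))"
      using f_Psi_product[OF D, of r0] by blast
    define w where "w x = (\<Prod>i\<in>UNIV. x $ i powr (a $ i - 1)) *
        exp (- tree_kummer_exponent E (c *\<^sub>R C) x) * indicator pos_orthant x" for x
    have fw: "f x = Z * w x" for x
    proof (cases "x \<in> pos_orthant")
      case True
      have "f x = Z * (\<Prod>i\<in>UNIV. tilt A c r0 i (comp r0 x i))"
        using Z(2)[OF Phi_pos[OF True], of r0] Psi_Phi[OF True] by simp
      then show ?thesis
        using True by (simp add: w_def tilt_product exponent_scale[OF c, of _ r0] a)
    qed (simp add: w_def f_zero)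
    \<comment> \<open>As \<open>f\<close> is \<open>Z\<close> times \<open>w\<close> and has mass 1,
      the integral of \<open>w\<close> is 1 / Z, and normalizing \<open>w\<close> gives back
      \<open>f\<close>.\<close>
    have "(\<integral>\<^sup>+ x. ennreal (f x) \<partial>lborel) = 1"
      using distributed_emeasure[OF X_density, of UNIV] emeasure_space_1 by simp
    then have "(LINT x|lborel. f x) = 1"
      by (subst integral_eq_nn_integral) (simp_all add: f_nonneg)
    then have "Z * (LINT x|lborel. w x) = 1" by (simp add: fw)
    then have "(LINT x|lborel. w x) = 1 / Z" using Z(1) by (simp add: eq_divide_eq ac_simps)
    then have "w x / (LINT y|lborel. w y) = f x" for x by (simp add: fw)
    then have "dist_prop_to w = density lborel (\<lambda>x. ennreal (f x))" by (simp add: dist_prop_to_def)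
    moreover have "distr M borel X = distr M lborel X" by (rule distr_cong) simp_all
    ultimately show ?thesis
      using distributed_distr_eq_density[OF X_density]
      by (simp add: tree_kummer_dist_def w_def[abs_def])
  qed
  have "a $ i > 0" for i using A[of i] by (simp add: a)
  then show ?thesis
    unfolding Let_def using c gamma kummer[OF _ refl] TK
    by (intro exI[of _ a] exI[of _ c] conjI allI impI)
qed

end
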